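(* Let $\beta\in(2/3,1]$ and let $$f(n)=\sum_{d\mid n}\frac{1}{d^{\beta}}\qquad(n\ge 1).$$ Then $$S_{f}(x)=C_{f}\,x+O\left(x^{1/3}(\log x)\right),$$ where $$S_f(x)=\sum_{n\leq x}f\left(\left[\frac{x}{n}\right]\right),\qquad C_{f}=\sum_{n=1}^{\infty}\frac{f(n)}{n(n+1)}.$$
   Context: $[t]$ denotes the floor of the real number $t$; sums over $n\le x$ run over positive integers. The asymptotic formula is for $x\to\infty$ with $\beta$ fixed, and the implied constant is independent of $x$. *)

theory Defs
  imports "HOL-Analysis.Analysis" "HOL-Library.Landau_Symbols"
begin

text \<open>Only the values at \<open>n \<ge> 1\<close> matter: the divisors of \<open>0\<close> form an infinite set,
  so the value at \<open>0\<close> is the dummy value \<open>0\<close>.\<close>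

definition sigma_neg :: "real \<Rightarrow> nat \<Rightarrow> real" where
  "sigma_neg \<beta> n = (\<Sum>d | d dvd n. 1 / real d powr \<beta>)"

text \<open>For \<open>1 \<le> n \<le> x\<close> the floor of \<open>x / n\<close> is at least \<open>1\<close>, so \<open>nat\<close> truncates nothing.\<close>

definition floor_sum :: "(nat \<Rightarrow> real) \<Rightarrow> real \<Rightarrow> real" where
  "floor_sum f x = (\<Sum>n | 1 \<le> n \<and> real n \<le> x. f (nat \<lfloor>x / real n\<rfloor>))"

text \<open>The series runs over positive integers; \<open>suminf\<close> starts at \<open>0\<close>, hence the index \<open>Suc n\<close>.\<close>

definition floor_sum_const :: "(nat \<Rightarrow> real) \<Rightarrow> real" where
  "floor_sum_const f = (\<Sum>n. f (Suc n) / (real (Suc n) * (real (Suc n) + 1)))"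

end

theory Submission
  imports Defs
begin

text \<open>
  Write \<open>psi u = frac u - 1/2\<close>. Opening the divisor sum inside \<open>f\<close> and exchanging summations, \<open>S\<^sub>f x\<close> is
  the sum over \<open>d\<close> of \<open>d powr -\<beta>\<close> times the number of \<open>n \<le> x\<close> with \<open>d dvd \<lfloor>x/n\<rfloor>\<close>. With \<open>y = x/d\<close>
  and \<open>a = 1/d\<close> this number counts the pairs \<open>m, n \<ge> 1\<close> with \<open>m n \<le> y < (m + a) n\<close>, that is,
  the lattice points between two hyperbolas. It therefore suffices to show that this count is
  \<open>y * (\<Sum>m\<ge>1. 1/m - 1/(m + a))\<close> with an error of order \<open>y powr (1/3) * (1 + ln y)\<close>, uniformly in \<open>a \<in> (0, 1]\<close>:
  the errors, weighted by \<open>d powr -\<beta>\<close>, then add up to a constant times \<open>x powr (1/3) * (1 + ln x)\<close> times the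
  series of \<open>d powr -(\<beta> + 1/3)\<close>, which converges because \<open>\<beta> > 2/3\<close>. The main terms add up to
  \<open>C\<^sub>f x\<close> by the same exchange of summations, now in a double series of nonnegative terms.

  The count (\<open>hyperbola_pair_count\<close>) is found by Dirichlet's hyperbola method, which turns the error into
  sums of \<open>psi (y / n)\<close>, \<open>psi (y / n - a)\<close> and \<open>psi (y / (n + a))\<close> over \<open>n \<le> sqrt y\<close>. The exponent
  \<open>1/3\<close> is that of Voronoi in the divisor problem; here it comes from van der Corput's method.
  The function \<open>psi\<close> lies between two box averages of itself, up to the length \<open>1/K\<close> of the box. The averages are differences of \<open>frac\<^sup>2 - frac\<close>, whose
  Fourier series converges absolutely (\<open>fourier_frac_square\<close>), so that sums of \<open>psi\<close> are controlled
  by exponential sums. These are bounded by the second derivative test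
  (\<open>exp_sum_second_difference_test\<close>), which rests on the inequality of Kusmin and Landau. For second
  differences of size \<open>c\<^sup>3\<close>, the choice \<open>K \<approx> 1/c\<close> balances the smoothing error against the exponential
  sums (\<open>psi_sum_second_difference_test\<close>), with no loss of a logarithm. On a dyadic block \<open>n \<approx> N\<close> the
  size is \<open>c \<approx> y powr (1/3) / N\<close>, so each block contributes \<open>O(y powr (1/3))\<close>,
  and the only logarithm is the number of blocks.
\<close>

section \<open>The Kusmin--Landau inequality\<close>

definition e1 :: "real \<Rightarrow> complex" where
  "e1 t = cis (2 * pi * t)"

lemma norm_e1 [simp]: "norm (e1 t) = 1"
  by (simp add: e1_def)

lemma e1_add: "e1 (s + t) = e1 s * e1 t"
  by (simp add: e1_def cis_mult ring_distribs)

lemma e1_of_int [simp]: "e1 (of_int m) = 1"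
  by (simp add: e1_def cis_conv_exp complex_eq_iff Re_exp Im_exp)

text \<open>
  Concavity of the sine on \<open>[0, \<pi>]\<close> puts its graph above the chords to the maximum at \<open>\<pi>/2\<close>.
\<close>
lemma sin_pi_ge:
  assumes "0 \<le> t" "t \<le> 1" "\<delta> \<le> t" "\<delta> \<le> 1 - t"
  shows "sin (pi * t) \<ge> 2 * \<delta>"
proof -
  have conc: "concave_on {0..pi} sin"
    by (rule f''_le0_imp_concave[where f' = cos and f'' = "\<lambda>x. - sin x"])
       (auto intro!: derivative_eq_intros sin_ge_zero)
  have half: "sin (pi * s) \<ge> 2 * s" if "0 \<le> s" "s \<le> 1/2" for s
  proof -
    have "sin ((1 - 2 * s) *\<^sub>R 0 + (2 * s) *\<^sub>R (pi/2)) \<ge> (1 - 2 * s) * sin 0 + (2 * s) * sin (pi/2)"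
      using that by (intro concave_onD[OF conc]) auto
    then show ?thesis by (simp add: mult.commute)
  qed
  show ?thesis
  proof (cases "t \<le> 1/2")
    case True
    with half[of t] assms show ?thesis by linarith
  next
    case False
    have "sin (pi * (1 - t)) = sin (pi * t)"
      by (simp add: right_diff_distrib sin_diff)
    moreover have "sin (pi * (1 - t)) \<ge> 2 * (1 - t)"
      using assms False by (intro half) auto
    ultimately have "sin (pi * t) \<ge> 2 * (1 - t)" by simp
    moreover have "2 * \<delta> \<le> 2 * (1 - t)" using assms by simp
    ultimately show ?thesis by (rule order.trans[rotated])
  qed
qed

text \<open>
  The real part does not depend on \<open>t\<close> and the imaginary part is monotone between integers. Hence the
  total variation of this function along a monotone sequence telescopes.
\<close>
lemma inverse_e1_minus_1:
  assumes "sin (pi * t) \<noteq> 0"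
  shows "1 / (e1 t - 1) = Complex (-1/2) (- cot (pi * t) / 2)"
proof -
  let ?s = "sin (pi * t)" and ?c = "cos (pi * t)"
  have e: "e1 t - 1 = Complex (- 2 * ?s\<^sup>2) (2 * ?s * ?c)"
    using sin_double[of "pi * t"] cos_double_sin[of "pi * t"]
    by (simp add: e1_def complex_eq_iff mult.assoc)
  have "Complex (-1/2) (- cot (pi * t) / 2) * (e1 t - 1) = 1"
    using assms sin_cos_squared_add[of "pi * t"]
    by (simp add: e complex_eq_iff cot_def field_simps power2_eq_square)
  moreover from this have "e1 t - 1 \<noteq> 0" by auto
  ultimately show ?thesis by (simp add: field_simps)
qed

lemma norm_e1_minus_1: "norm (e1 t - 1) = 2 * \<bar>sin (pi * t)\<bar>"
proof -
  let ?s = "sin (pi * t)" and ?c = "cos (pi * t)"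
  have e: "e1 t - 1 = Complex (- 2 * ?s\<^sup>2) (2 * ?s * ?c)"
    using sin_double[of "pi * t"] cos_double_sin[of "pi * t"]
    by (simp add: e1_def complex_eq_iff mult.assoc)
  have "(- 2 * ?s\<^sup>2)\<^sup>2 + (2 * ?s * ?c)\<^sup>2 = (2 * ?s)\<^sup>2 * (?s\<^sup>2 + ?c\<^sup>2)"
    by algebra
  also have "\<dots> = (2 * ?s)\<^sup>2" by simp
  finally have "norm (e1 t - 1) = sqrt ((2 * ?s)\<^sup>2)"
    by (simp only: e cmod_def complex.sel)
  then show ?thesis by (simp only: real_sqrt_abs abs_mult abs_numeral)
qed

text \<open>
  If \<open>E\<close> is a geometric sequence, then \<open>w\<close> is the constant \<open>1 / (q - 1)\<close> and this is the geometric sum formula.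
  For a slowly varying ratio the last sum is the price.
\<close>
lemma abel_summation_quotient:
  fixes E w :: "nat \<Rightarrow> 'a :: comm_ring_1"
  assumes "a \<le> b" and "\<And>n. a \<le> n \<Longrightarrow> n \<le> b \<Longrightarrow> E n = (E (Suc n) - E n) * w n"
  shows "(\<Sum>n=a..b. E n)
           = E (Suc b) * w b - E a * w a - (\<Sum>n=a..<b. E (Suc n) * (w (Suc n) - w n))"
  using assms
proof (induction b rule: dec_induct)
  case base
  then show ?case by (simp add: algebra_simps)
next
  case (step b)
  have "E (Suc b) = (E (Suc (Suc b)) - E (Suc b)) * w (Suc b)"
    using step by auto
  with step(1) have "(\<Sum>n=a..Suc b. E n) = (\<Sum>n=a..b. E n) + (E (Suc (Suc b)) - E (Suc b)) * w (Suc b)"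
    by simp
  also have "(\<Sum>n=a..b. E n)
      = E (Suc b) * w b - E a * w a - (\<Sum>n=a..<b. E (Suc n) * (w (Suc n) - w n))"
    using step by auto
  finally show ?case using step(1) by (simp only: sum.atLeastLessThan_Suc) (simp add: algebra_simps)
qed

lemma cot_antimono:
  assumes "0 < s" "s \<le> t" "t < 1"
  shows "cot (pi * t) \<le> cot (pi * s)"
proof -
  have pos: "sin (pi * s) > 0" "sin (pi * t) > 0"
    using assms by (auto intro!: sin_gt_zero)
  have "pi * (t - s) \<le> pi * 1" using assms by (intro mult_left_mono) auto
  then have "sin (pi * t - pi * s) \<ge> 0"
    using assms by (intro sin_ge_zero) (auto simp: algebra_simps)
  then show ?thesis
    using pos by (simp add: cot_def sin_diff field_simps)
qed

text \<open>
  The sequence \<open>e1 (f n)\<close> is nearly geometric with ratio \<open>e1\<close> of the difference of \<open>f\<close>. The weights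
  \<open>w\<close> of \<open>abel_summation_quotient\<close> are at most \<open>1/(4\<delta>)\<close> in size since the ratio stays away from \<open>1\<close>, and their
  total variation is a telescoping sum of cotangents since the differences are monotone.
\<close>
lemma kusmin_landau:
  fixes f :: "nat \<Rightarrow> real" and m :: int
  assumes \<delta>: "\<delta> > 0"
    and rng: "\<And>n. a \<le> n \<Longrightarrow> n < b \<Longrightarrow> of_int m + \<delta> \<le> f (Suc n) - f n"
      "\<And>n. a \<le> n \<Longrightarrow> n < b \<Longrightarrow> f (Suc n) - f n \<le> of_int m + 1 - \<delta>"
    and mono: "\<And>n. a \<le> n \<Longrightarrow> Suc n < b \<Longrightarrow> f (Suc n) - f n \<le> f (Suc (Suc n)) - f (Suc n)"
  shows "norm (\<Sum>n=a..<b. e1 (f n)) \<le> 1 / \<delta>"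
proof (cases "a < b")
  case False
  then show ?thesis using \<delta> by simp
next
  case True
  then obtain c where c: "b = Suc c" "a \<le> c" by (cases b) auto
  define t where "t n = f (Suc n) - f n - of_int m" for n
  define w where "w n = 1 / (e1 (t n) - 1)" for n
  have t: "\<delta> \<le> t n" "t n \<le> 1 - \<delta>" if "a \<le> n" "n \<le> c" for n
    using rng[of n] that c by (auto simp: t_def)
  have t_mono: "t n \<le> t (Suc n)" if "a \<le> n" "n < c" for n
    using mono[of n] that c by (auto simp: t_def)
  have s: "sin (pi * t n) \<ge> 2 * \<delta>" if "a \<le> n" "n \<le> c" for n
    using t[OF that] \<delta> by (intro sin_pi_ge) auto
  have w: "w n = Complex (-1/2) (- cot (pi * t n) / 2)" if "a \<le> n" "n \<le> c" for n
    unfolding w_def using s[OF that] \<delta> by (intro inverse_e1_minus_1) auto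
  have norm_w: "norm (w n) \<le> 1 / (4 * \<delta>)" if "a \<le> n" "n \<le> c" for n
  proof -
    have "norm (e1 (t n) - 1) = 2 * \<bar>sin (pi * t n)\<bar>"
      by (rule norm_e1_minus_1)
    then show ?thesis
      using s[OF that] \<delta> by (simp add: w_def norm_divide frac_le)
  qed
  have E: "e1 (f n) = (e1 (f (Suc n)) - e1 (f n)) * w n" if "a \<le> n" "n \<le> c" for n
  proof -
    have "e1 (f (Suc n)) = e1 (f n + t n + of_int m)" by (simp add: t_def)
    also have "\<dots> = e1 (f n) * e1 (t n)" by (simp only: e1_add e1_of_int)  simp
    finally have 1: "e1 (f (Suc n)) = e1 (f n) * e1 (t n)" .
    have "w n \<noteq> 0" using w[OF that] by (auto simp: complex_eq_iff)
    then have "e1 (t n) - 1 \<noteq> 0" by (auto simp: w_def)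
    then show ?thesis by (simp add: 1 w_def field_simps)
  qed
  have dw: "norm (w (Suc n) - w n) = (cot (pi * t n) - cot (pi * t (Suc n))) / 2"
    if "a \<le> n" "n < c" for n
  proof -
    have "w (Suc n) - w n = Complex 0 ((cot (pi * t n) - cot (pi * t (Suc n))) / 2)"
      using w[of n] w[of "Suc n"] that by (simp add: complex_eq_iff field_simps)
    moreover have "cot (pi * t (Suc n)) \<le> cot (pi * t n)"
      using t[of n] t[of "Suc n"] t_mono[of n] that \<delta> by (intro cot_antimono) auto
    ultimately show ?thesis by (simp add: cmod_def)
  qed
  have cot: "\<bar>cot (pi * t n)\<bar> / 2 \<le> 1 / (4 * \<delta>)" if "a \<le> n" "n \<le> c" for n
    using abs_Im_le_cmod[of "w n"] norm_w[OF that] w[OF that] by simp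
  have "norm (\<Sum>n=a..<c. e1 (f (Suc n)) * (w (Suc n) - w n))
          \<le> (\<Sum>n=a..<c. norm (w (Suc n) - w n))"
    by (rule order.trans[OF norm_sum]) (simp add: norm_mult)
  also have "\<dots> = (\<Sum>n=a..<c. (- cot (pi * t (Suc n)) / 2) - (- cot (pi * t n) / 2))"
    by (intro sum.cong) (auto simp: dw field_simps)
  also have "\<dots> = (- cot (pi * t c) / 2) - (- cot (pi * t a) / 2)"
    by (rule sum_Suc_diff'[OF c(2)])
  also have "\<dots> \<le> 2 / (4 * \<delta>)"
    using cot[of a] cot[of c] c by (simp add: field_simps)
  finally have 1: "norm (\<Sum>n=a..<c. e1 (f (Suc n)) * (w (Suc n) - w n)) \<le> 2 / (4 * \<delta>)" .
  have "{a..<b} = {a..c}" using c by auto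
  then have "norm (\<Sum>n=a..<b. e1 (f n))
      = norm (e1 (f (Suc c)) * w c - e1 (f a) * w a - (\<Sum>n=a..<c. e1 (f (Suc n)) * (w (Suc n) - w n)))"
    using abel_summation_quotient[OF c(2), of "\<lambda>n. e1 (f n)" w] E by auto
  also have "\<dots> \<le> norm (w c) + norm (w a) + 2 / (4 * \<delta>)"
    by (intro norm_triangle_le_diff add_mono 1) (simp_all add: norm_mult)
  also have "\<dots> \<le> 1 / (4 * \<delta>) + 1 / (4 * \<delta>) + 2 / (4 * \<delta>)"
    using norm_w[of a] norm_w[of c] c by (intro add_mono) auto
  finally show ?thesis by (simp add: field_simps)
qed

section \<open>The second derivative test for exponential sums\<close>

lemma card_le_diameter:
  fixes S :: "nat set"
  assumes "D \<ge> 0" and "\<And>i j. i \<in> S \<Longrightarrow> j \<in> S \<Longrightarrow> i \<le> j \<Longrightarrow> real (j - i) \<le> D"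
  shows "real (card S) \<le> D + 1"
proof (cases "S = {}")
  case True
  then show ?thesis using assms by simp
next
  case False
  define i where "i = (LEAST i. i \<in> S)"
  have i: "i \<in> S" "\<And>j. j \<in> S \<Longrightarrow> i \<le> j"
    using False unfolding i_def by (auto intro: LeastI Least_le)
  have sub: "S \<subseteq> {i..i + nat \<lfloor>D\<rfloor>}"
  proof
    fix j assume j: "j \<in> S"
    have "real (j - i) \<le> D" using assms i j by auto
    then have "int (j - i) \<le> \<lfloor>D\<rfloor>" by (simp add: le_floor_iff)
    then show "j \<in> {i..i + nat \<lfloor>D\<rfloor>}" using i(2)[OF j] by auto
  qed
  then have "card S \<le> card {i..i + nat \<lfloor>D\<rfloor>}" by (intro card_mono) auto
  then have "real (card S) \<le> real (nat \<lfloor>D\<rfloor>) + 1" by simp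
  also have "real (nat \<lfloor>D\<rfloor>) \<le> D" using assms(1) by simp
  finally show ?thesis by simp
qed

lemma convex_nat_set_is_interval:
  fixes S :: "nat set"
  assumes "finite S" and "\<And>i j k. i \<in> S \<Longrightarrow> k \<in> S \<Longrightarrow> i \<le> j \<Longrightarrow> j \<le> k \<Longrightarrow> j \<in> S"
  shows "\<exists>a b. S = {a..<b}"
proof (cases "S = {}")
  case True
  then have "S = {0..<0}" by simp
  then show ?thesis by blast
next
  case False
  have "S = {Min S..<Suc (Max S)}"
  proof
    show "S \<subseteq> {Min S..<Suc (Max S)}"
      using assms(1) by (simp add: subset_iff less_Suc_eq_le)
    show "{Min S..<Suc (Max S)} \<subseteq> S"
    proof
      fix j assume "j \<in> {Min S..<Suc (Max S)}"
      then have "Min S \<le> j" "j \<le> Max S" by simp_all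
      with Min_in[OF assms(1) False] Max_in[OF assms(1) False] show "j \<in> S"
        by (rule assms(2))
    qed
  qed
  then show ?thesis by blast
qed

text \<open>
  The differences \<open>\<theta>\<close> of \<open>f\<close> increase by at least \<open>\<mu>\<close> and at most \<open>h\<mu>\<close> at each step, so they visit at most
  \<open>h\<mu>(B - A) + 2\<close> intervals between consecutive integers. In one such interval at most \<open>2(\<delta>/\<mu> + 1)\<close> indices have
  \<open>\<theta>\<close> within \<open>\<delta>\<close> of an end and are estimated trivially; the others contribute at most \<open>1/\<delta>\<close> by
  \<open>kusmin_landau\<close>. The choice \<open>\<delta> = sqrt \<mu>\<close> balances the two.
\<close>
lemma exp_sum_second_difference_test:
  fixes f :: "nat \<Rightarrow> real"
  assumes lam: "0 < \<mu>" and AB: "A \<le> B"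
    and D2: "\<And>n. A \<le> n \<Longrightarrow> n < B \<Longrightarrow> \<mu> \<le> f (Suc (Suc n)) - 2 * f (Suc n) + f n"
            "\<And>n. A \<le> n \<Longrightarrow> n < B \<Longrightarrow> f (Suc (Suc n)) - 2 * f (Suc n) + f n \<le> h * \<mu>"
  shows "norm (\<Sum>n=A..<B. e1 (f n)) \<le> 5 * (h * real (B - A) * sqrt \<mu> + 2 / sqrt \<mu>)"
proof (cases "A < B \<and> \<mu> \<le> 1")
  case False
  have "norm (\<Sum>n=A..<B. e1 (f n)) \<le> (\<Sum>n=A..<B. norm (e1 (f n)))"
    by (rule norm_sum)
  also have "\<dots> = real (B - A)" by simp
  also have "\<dots> \<le> 5 * (h * real (B - A) * sqrt \<mu> + 2 / sqrt \<mu>)"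
  proof (cases "A < B")
    case True
    then have "\<mu> * 1 \<le> \<mu> * h" using D2[of A] by (simp add: mult.commute)
    then have h: "1 \<le> h" using lam by (simp only: mult_le_cancel_left_pos)
    have "1 * real (B - A) * 1 \<le> h * real (B - A) * sqrt \<mu>"
      using h False True by (intro mult_mono) auto
    then have "real (B - A) \<le> 5 * (h * real (B - A) * sqrt \<mu>)" by simp
    moreover have "0 \<le> 5 * (2 / sqrt \<mu>)" using lam by simp
    ultimately show ?thesis unfolding distrib_left by linarith
  qed (use AB lam in auto)
  finally show ?thesis .
next
  case True
  then have "\<mu> * 1 \<le> \<mu> * h" using D2[of A] by (simp add: mult.commute)
  then have h: "1 \<le> h" using lam by (simp only: mult_le_cancel_left_pos)
  define \<theta> where "\<theta> n = f (Suc n) - f n" for n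
  define \<delta> where "\<delta> = sqrt \<mu>"
  have \<delta>: "0 < \<delta>" "\<delta> \<le> 1" "\<delta>\<^sup>2 = \<mu>" using lam True by (auto simp: \<delta>_def)
  have inc: "\<theta> i + \<mu> * real (j - i) \<le> \<theta> j \<and> \<theta> j \<le> \<theta> i + h * \<mu> * real (j - i)"
    if "A \<le> i" "i \<le> j" "j \<le> B" for i j
    using that(2,3)
  proof (induction j rule: dec_induct)
    case (step n)
    then show ?case
      using D2[of n] that(1) by (simp add: \<theta>_def Suc_diff_le algebra_simps)
  qed simp
  have mono: "\<theta> i \<le> \<theta> j" if "A \<le> i" "i \<le> j" "j \<le> B" for i j
    using inc[OF that] lam by (smt (verit) mult_nonneg_nonneg of_nat_0_le_iff)
  have short: "real (card {n\<in>{A..<B}. c \<le> \<theta> n \<and> \<theta> n \<le> c + \<delta>}) \<le> 1 / \<delta> + 1" for c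
  proof (rule card_le_diameter)
    fix i j assume ij: "i \<in> {n\<in>{A..<B}. c \<le> \<theta> n \<and> \<theta> n \<le> c + \<delta>}"
      "j \<in> {n\<in>{A..<B}. c \<le> \<theta> n \<and> \<theta> n \<le> c + \<delta>}" "i \<le> j"
    then have "\<delta>\<^sup>2 * real (j - i) \<le> \<delta>" using inc[of i j] \<delta>(3) by auto
    then show "real (j - i) \<le> 1 / \<delta>" using \<delta>(1) by (simp add: power2_eq_square field_simps)
  qed (use \<delta> in simp)
  define S where "S m = {n\<in>{A..<B}. \<lfloor>\<theta> n\<rfloor> = m}" for m
  have block: "norm (\<Sum>n\<in>S m. e1 (f n)) \<le> 5 / \<delta>" for m
  proof -
    define U where "U = {n\<in>{A..<B}. of_int m + \<delta> \<le> \<theta> n \<and> \<theta> n \<le> of_int m + 1 - \<delta>}"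
    define V where "V = S m - U"
    have "U \<subseteq> S m"
    proof
      fix n assume "n \<in> U"
      then show "n \<in> S m" using \<delta>(1) by (auto simp: U_def S_def intro!: floor_unique)
    qed
    have "finite (S m)" by (simp add: S_def)
    have "V \<subseteq> {n\<in>{A..<B}. of_int m \<le> \<theta> n \<and> \<theta> n \<le> of_int m + \<delta>}
               \<union> {n\<in>{A..<B}. of_int m + 1 - \<delta> \<le> \<theta> n \<and> \<theta> n \<le> of_int m + 1 - \<delta> + \<delta>}"
      (is "_ \<subseteq> ?V1 \<union> ?V2")
    proof
      fix n assume n: "n \<in> V"
      then have "of_int m \<le> \<theta> n" "\<theta> n < of_int m + 1"
        unfolding V_def S_def by (auto simp: floor_eq_iff)
      with n show "n \<in> ?V1 \<union> ?V2"
        unfolding V_def S_def U_def by (auto simp: not_le)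
    qed
    then have "card V \<le> card ?V1 + card ?V2"
      by (intro order.trans[OF card_mono card_Un_le]) auto
    then have "real (card V) \<le> real (card ?V1) + real (card ?V2)"
      unfolding of_nat_add[symmetric] by (rule of_nat_mono)
    then have cardV: "real (card V) \<le> 2 / \<delta> + 2"
      using short[of "of_int m"] short[of "of_int m + 1 - \<delta>"] by simp
    have "\<exists>a b. U = {a..<b}"
    proof (rule convex_nat_set_is_interval)
      fix i j k assume "i \<in> U" "k \<in> U" "i \<le> j" "j \<le> k"
      then show "j \<in> U"
        using mono[of i j] mono[of j k] by (auto simp: U_def)
    qed (simp add: U_def)
    then obtain a b where ab: "U = {a..<b}" by blast
    have "norm (\<Sum>n=a..<b. e1 (f n)) \<le> 1 / \<delta>"
    proof (rule kusmin_landau[where m = m])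
      fix n assume "a \<le> n" "n < b"
      then have "n \<in> U" by (simp add: ab)
      then show "of_int m + \<delta> \<le> f (Suc n) - f n" "f (Suc n) - f n \<le> of_int m + 1 - \<delta>"
        by (auto simp: U_def \<theta>_def)
    next
      fix n assume "a \<le> n" "Suc n < b"
      then have "n \<in> U" by (simp add: ab)
      then show "f (Suc n) - f n \<le> f (Suc (Suc n)) - f (Suc n)"
        using D2(1)[of n] lam by (auto simp: U_def)
    qed (use \<delta> in simp)
    moreover have "norm (\<Sum>n\<in>V. e1 (f n)) \<le> real (card V)"
      by (rule order.trans[OF norm_sum]) simp
    moreover have "(\<Sum>n\<in>S m. e1 (f n)) = (\<Sum>n\<in>V. e1 (f n)) + (\<Sum>n\<in>U. e1 (f n))"
      unfolding V_def by (rule sum.subset_diff) fact+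
    ultimately have "norm (\<Sum>n\<in>S m. e1 (f n)) \<le> 3 / \<delta> + 2"
      using cardV norm_triangle_ineq[of "\<Sum>n\<in>V. e1 (f n)" "\<Sum>n\<in>U. e1 (f n)"] by (simp add: ab)
    also have "\<dots> \<le> 5 / \<delta>" using \<delta> by (simp add: field_simps)
    finally show ?thesis .
  qed
  define M where "M = {\<lfloor>\<theta> A\<rfloor>..\<lfloor>\<theta> (B - 1)\<rfloor>}"
  have "\<theta> (B - 1) \<le> \<theta> A + h * \<mu> * real (B - 1 - A)"
    using inc[of A "B - 1"] True by auto
  also have "h * \<mu> * real (B - 1 - A) \<le> h * \<mu> * real (B - A)"
    using h lam by (intro mult_left_mono) auto
  finally have "\<theta> (B - 1) \<le> \<theta> A + h * \<mu> * real (B - A)" by simp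
  then have "of_int (\<lfloor>\<theta> (B - 1)\<rfloor> - \<lfloor>\<theta> A\<rfloor> + 1) \<le> h * \<mu> * real (B - A) + 2"
    by (simp; linarith)
  moreover have "\<lfloor>\<theta> A\<rfloor> \<le> \<lfloor>\<theta> (B - 1)\<rfloor>"
    using mono[of A "B - 1"] True by (intro floor_mono) auto
  ultimately have cardM: "real (card M) \<le> h * \<mu> * real (B - A) + 2"
    by (simp add: M_def)
  have "(\<Sum>n=A..<B. e1 (f n)) = (\<Sum>m\<in>M. \<Sum>n\<in>S m. e1 (f n))"
    unfolding S_def
  proof (rule sum.group[symmetric])
    show "(\<lambda>n. \<lfloor>\<theta> n\<rfloor>) ` {A..<B} \<subseteq> M"
      using mono by (auto simp: M_def intro!: floor_mono)
  qed (auto simp: M_def)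
  also have "norm \<dots> \<le> (\<Sum>m\<in>M. 5 / \<delta>)"
    using block by (intro sum_norm_le) auto
  also have "\<dots> = real (card M) * (5 / \<delta>)" by simp
  also have "\<dots> \<le> (h * \<mu> * real (B - A) + 2) * (5 / \<delta>)"
    using \<delta> by (intro mult_right_mono cardM) auto
  also have "\<dots> = 5 * (h * real (B - A) * \<delta> + 2 / \<delta>)"
    using \<delta>(1) by (simp add: \<delta>(3)[symmetric] power2_eq_square field_simps)
  finally show ?thesis by (simp add: \<delta>_def)
qed

section \<open>The Fourier series of the second periodic Bernoulli polynomial\<close>

lemma summable_inverse_square: "summable (\<lambda>n. 1 / (real n)\<^sup>2)"
  using inverse_power_summable[of 2, where 'a = real] by (simp add: field_simps)

text \<open>
  Continuity in both variables at once serves two limits: \<open>r \<rightarrow> 1\<close> at fixed angle (Abel summation), and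
  the angle tending to a multiple of \<open>2\<pi>\<close> at \<open>r = 1\<close>. The summand at \<open>n = 0\<close> vanishes, as \<open>1 / 0 = 0\<close>.
\<close>
lemma continuous_on_cos_power_series:
  "continuous_on ({0..1} \<times> UNIV) (\<lambda>p. \<Sum>n. fst p ^ n * cos (real n * snd p) / (real n)\<^sup>2)"
proof (rule uniform_limit_theorem)
  show "uniform_limit ({0..1} \<times> UNIV) (\<lambda>m p. \<Sum>n<m. fst p ^ n * cos (real n * snd p) / (real n)\<^sup>2)
          (\<lambda>p. \<Sum>n. fst p ^ n * cos (real n * snd p) / (real n)\<^sup>2) sequentially"
  proof (rule Weierstrass_m_test[OF _ summable_inverse_square])
    fix n and p :: "real \<times> real" assume "p \<in> {0..1} \<times> UNIV"
    then have "\<bar>fst p ^ n\<bar> * \<bar>cos (real n * snd p)\<bar> \<le> 1 * 1"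
      by (intro mult_mono) (auto simp: power_le_one)
    then show "norm (fst p ^ n * cos (real n * snd p) / (real n)\<^sup>2) \<le> 1 / (real n)\<^sup>2"
      by (simp add: abs_mult divide_right_mono)
  qed
  show "\<forall>\<^sub>F m in sequentially. continuous_on ({0..1} \<times> UNIV)
          (\<lambda>p. \<Sum>n<m. fst p ^ n * cos (real n * snd p) / (real n)\<^sup>2)"
    unfolding divide_inverse by (intro always_eventually allI continuous_intros)
qed simp

text \<open>
  For \<open>r < 1\<close> the differentiated series still converges uniformly; it is the imaginary part of the power series of
  \<open>Ln (1 - z)\<close> at \<open>z = r cis t\<close>.
\<close>
lemma has_derivative_cos_power_series:
  assumes r: "0 \<le> r" "r < 1"
  shows "((\<lambda>t. \<Sum>n. r ^ n * cos (real n * t) / (real n)\<^sup>2)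
            has_field_derivative Im (Ln (1 - of_real r * cis t))) (at t)"
proof -
  have lim: "uniformly_convergent_on UNIV (\<lambda>m t. \<Sum>n<m. - (r ^ n * sin (real n * t) / real n))"
  proof (rule Weierstrass_m_test')
    show "summable (\<lambda>n. r ^ n)" using r by (intro summable_geometric) auto
  next
    fix n :: nat and t :: real
    have "\<bar>r ^ n * sin (real n * t)\<bar> / real n \<le> r ^ n / 1" if "n \<noteq> 0"
      using r that by (intro frac_le) (auto simp: abs_mult mult_left_le)
    then show "norm (- (r ^ n * sin (real n * t) / real n)) \<le> r ^ n"
      using r by (cases "n = 0") auto
  qed
  have "((\<lambda>t. \<Sum>n. r ^ n * cos (real n * t) / (real n)\<^sup>2)
          has_field_derivative (\<Sum>n. - (r ^ n * sin (real n * t) / real n))) (at t)"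
  proof (rule has_field_derivative_series'(2)[OF convex_UNIV _ lim, where ?x0.0 = 0])
    fix n :: nat and t :: real
    show "((\<lambda>t. r ^ n * cos (real n * t) / (real n)\<^sup>2)
            has_field_derivative - (r ^ n * sin (real n * t) / real n)) (at t within UNIV)"
      by (cases "n = 0") (auto intro!: derivative_eq_intros simp: power2_eq_square)
    show "summable (\<lambda>n. r ^ n * cos (real n * 0) / (real n)\<^sup>2)"
    proof (rule summable_comparison_test'[OF summable_inverse_square])
      fix n :: nat
      show "norm (r ^ n * cos (real n * 0) / (real n)\<^sup>2) \<le> 1 / (real n)\<^sup>2"
        using r by (simp add: abs_mult power_le_one divide_right_mono)
    qed
  qed auto
  moreover have "(\<lambda>n. - (r ^ n * sin (real n * t) / real n)) sums Im (Ln (1 - of_real r * cis t))"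
  proof -
    have "norm (- (of_real r * cis t)) < 1" using r by (simp add: norm_mult)
    from sums_Im[OF Ln_series'[OF this]] show ?thesis
      by (simp add: power_mult_distrib Complex.DeMoivre Im_divide_of_nat flip: of_real_power)
  qed
  ultimately show ?thesis by (simp add: sums_iff)
qed

text \<open>
  In polar form \<open>1 - cis t = 2 sin (t/2) cis ((t - \<pi>)/2)\<close>.
\<close>
lemma Im_Ln_1_minus_cis:
  assumes "0 < t" "t < 2 * pi"
  shows "Im (Ln (1 - cis t)) = (t - pi) / 2"
proof -
  have s: "sin (t / 2) > 0" using assms by (intro sin_gt_zero) auto
  have "1 - cis t = of_real (2 * sin (t / 2)) * cis ((t - pi) / 2)"
    using sin_double[of "t / 2"] cos_double_sin[of "t / 2"]
    by (simp add: complex_eq_iff diff_divide_distrib sin_diff cos_diff power2_eq_square)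
  also have "\<dots> = exp (Complex (ln (2 * sin (t / 2))) ((t - pi) / 2))"
    using s by (simp add: exp_eq_polar Complex_eq)
  finally have "1 - cis t = exp (Complex (ln (2 * sin (t / 2))) ((t - pi) / 2))" .
  moreover have "Ln (exp (Complex (ln (2 * sin (t / 2))) ((t - pi) / 2)))
      = Complex (ln (2 * sin (t / 2))) ((t - pi) / 2)"
    using assms by (intro Ln_exp) auto
  ultimately show ?thesis by simp
qed

lemma Re_1_minus_cis_pos:
  assumes "0 < t" "t < 2 * pi" "0 \<le> r" "r \<le> 1"
  shows "Re (1 - of_real r * cis t) > 0"
proof -
  have "cos t < 1"
  proof -
    have "sin (t / 2) > 0" using assms by (intro sin_gt_zero) auto
    then show ?thesis using cos_double_sin[of "t / 2"] by simp
  qed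
  moreover have "r * cos t \<le> 1 * cos t" if "cos t \<ge> 0"
    using that assms by (intro mult_right_mono) auto
  moreover have "r * cos t \<le> 0" if "cos t < 0"
    using that assms by (simp add: mult_nonneg_nonpos)
  ultimately have "r * cos t < 1" by (cases "cos t \<ge> 0") auto
  then show ?thesis by simp
qed

text \<open>
  Integrate \<open>has_derivative_cos_power_series\<close> over \<open>[a, b]\<close> and let \<open>r \<rightarrow> 1\<close>. The integrands are bounded by \<open>\<pi>\<close> and
  tend to \<open>(t - \<pi>)/2\<close>, so the integrals converge by dominated convergence.
\<close>
lemma cos_series_diff:
  assumes "0 < a" "a \<le> b" "b < 2 * pi"
  shows "(\<Sum>n. cos (real n * b) / (real n)\<^sup>2) - (\<Sum>n. cos (real n * a) / (real n)\<^sup>2)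
           = (b\<^sup>2 / 4 - pi * b / 2) - (a\<^sup>2 / 4 - pi * a / 2)"
proof -
  define G where "G r t = (\<Sum>n. r ^ n * cos (real n * t) / (real n)\<^sup>2)" for r t :: real
  define g where "g r t = Im (Ln (1 - of_real r * cis t))" for r t :: real
  \<comment> \<open>any sequence in \<open>[0, 1)\<close> with limit \<open>1\<close>\<close>
  define r where "r k = 1 - 1 / real (Suc k)" for k
  have r: "0 \<le> r k" "r k < 1" for k by (auto simp: r_def field_simps)
  have r_lim: "r \<longlonglongrightarrow> 1"
    unfolding r_def using tendsto_diff[OF tendsto_const LIMSEQ_inverse_real_of_nat, of "1::real"]
    by (simp add: field_simps)
  have G_lim: "(\<lambda>k. G (r k) t) \<longlonglongrightarrow> G 1 t" for t
  proof -
    have "(\<lambda>k. (\<lambda>p. G (fst p) (snd p)) (r k, t)) \<longlonglongrightarrow> (\<lambda>p. G (fst p) (snd p)) (1, t)"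
    proof (rule continuous_on_tendsto_compose[where s = "{0..1} \<times> UNIV"])
      show "continuous_on ({0..1} \<times> UNIV) (\<lambda>p. G (fst p) (snd p))"
        unfolding G_def by (rule continuous_on_cos_power_series)
      show "(\<lambda>k. (r k, t)) \<longlonglongrightarrow> (1, t)" by (intro tendsto_intros r_lim)
      show "\<forall>\<^sub>F k in sequentially. (r k, t) \<in> {0..1} \<times> UNIV"
        using r by (auto intro!: always_eventually less_imp_le)
    qed simp
    then show ?thesis by simp
  qed
  have FTC: "(g (r k) has_integral (G (r k) b - G (r k) a)) {a..b}" for k
    using assms has_derivative_cos_power_series[OF r(1)[of k] r(2)[of k]]
    unfolding G_def g_def
    by (intro fundamental_theorem_of_calculus)
       (auto intro: has_field_derivative_at_within simp flip: has_real_derivative_iff_has_vector_derivative)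
  have "((\<lambda>t. (t - pi) / 2) has_integral (b\<^sup>2 / 4 - pi * b / 2) - (a\<^sup>2 / 4 - pi * a / 2)) {a..b}"
    using assms
    by (intro fundamental_theorem_of_calculus)
       (auto intro!: derivative_eq_intros simp: field_simps
             simp flip: has_real_derivative_iff_has_vector_derivative)
  moreover have "((\<lambda>t. (t - pi) / 2) has_integral (G 1 b - G 1 a)) {a..b}"
  proof (rule has_integral_dominated_convergence[OF FTC, where h = "\<lambda>_. pi"])
    show "\<forall>t\<in>{a..b}. norm (g (r k) t) \<le> pi" for k
    proof
      fix t assume "t \<in> {a..b}"
      then have "Re (1 - of_real (r k) * cis t) > 0"
        using assms r[of k] by (intro Re_1_minus_cis_pos) auto
      then have "1 - of_real (r k) * cis t \<noteq> 0" by (intro notI) (simp only: zero_complex.sel)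
      then show "norm (g (r k) t) \<le> pi"
        using mpi_less_Im_Ln[of "1 - of_real (r k) * cis t"] Im_Ln_le_pi[of "1 - of_real (r k) * cis t"]
        unfolding g_def real_norm_def abs_le_iff by linarith
    qed
    show "\<forall>t\<in>{a..b}. (\<lambda>k. g (r k) t) \<longlonglongrightarrow> (t - pi) / 2"
    proof
      fix t assume "t \<in> {a..b}"
      then have t: "0 < t" "t < 2 * pi" using assms by auto
      have "(\<lambda>k. g (r k) t) \<longlonglongrightarrow> Im (Ln (1 - of_real 1 * cis t))"
        unfolding g_def
      proof (intro tendsto_intros r_lim)
        have "Re (1 - of_real 1 * cis t) > 0" using t by (intro Re_1_minus_cis_pos) auto
        then show "1 - of_real 1 * cis t \<notin> \<real>\<^sub>\<le>\<^sub>0" by (auto simp: complex_nonpos_Reals_iff)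
      qed
      then show "(\<lambda>k. g (r k) t) \<longlonglongrightarrow> (t - pi) / 2"
        using Im_Ln_1_minus_cis[OF t] by simp
    qed
  qed (auto intro: tendsto_diff G_lim integrable_const_ivl)
  ultimately have "(b\<^sup>2 / 4 - pi * b / 2) - (a\<^sup>2 / 4 - pi * a / 2) = G 1 b - G 1 a"
    by (rule has_integral_unique)
  then show ?thesis by (simp add: G_def)
qed

text \<open>
  By \<open>cos_series_diff\<close> the cosine series and the quadratic polynomial differ by a constant on \<open>(0, 2\<pi>)\<close>, and by
  continuity also at the end points. The constant cancels in the difference, and periodicity gives the rest.
\<close>
lemma fourier_frac_square:
  "(\<lambda>n. (cos (real n * (2 * pi * u)) - cos (real n * (2 * pi * v))) / (real n)\<^sup>2) sums
     (pi\<^sup>2 * (((frac u)\<^sup>2 - frac u) - ((frac v)\<^sup>2 - frac v)))"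
proof -
  define F where "F t = (\<Sum>n. cos (real n * t) / (real n)\<^sup>2)" for t :: real
  have summ: "summable (\<lambda>n. cos (real n * t) / (real n)\<^sup>2)" for t
    by (rule summable_comparison_test'[OF summable_inverse_square]) (simp add: divide_right_mono)
  have cont: "continuous_on UNIV F"
  proof -
    have "continuous_on UNIV ((\<lambda>p. \<Sum>n. fst p ^ n * cos (real n * snd p) / (real n)\<^sup>2) \<circ> (\<lambda>t::real. (1, t)))"
      by (intro continuous_on_compose continuous_intros
            continuous_on_subset[OF continuous_on_cos_power_series]) auto
    then show ?thesis by (simp add: o_def F_def[abs_def])
  qed
  define D where "D t = F t - (t\<^sup>2 / 4 - pi * t / 2)" for t
  have D: "D t = D pi" if "t \<in> {0..2 * pi}" for t
  proof (rule continuous_constant_on_closure[where S = "{0<..<2 * pi}" and f = D and x = t and a = "D pi"])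
    show "continuous_on (closure {0<..<2 * pi}) D"
      unfolding D_def by (intro continuous_intros continuous_on_subset[OF cont]) auto
    show "D s = D pi" if "s \<in> {0<..<2 * pi}" for s
      using that cos_series_diff[of s pi] cos_series_diff[of pi s]
      by (cases "s \<le> pi") (auto simp: D_def F_def)
  qed (use that in simp)
  have per: "F (2 * pi * u) = D pi + pi\<^sup>2 * ((frac u)\<^sup>2 - frac u)" for u
  proof -
    have "cos (real n * (2 * pi * u)) = cos (real n * (2 * pi * frac u))" for n
    proof -
      have "real n * (2 * pi * u) = real n * (2 * pi * frac u) + 2 * pi * of_int (int n * \<lfloor>u\<rfloor>)"
        by (simp add: frac_def algebra_simps)
      then show ?thesis by (simp only: cos_add cos_int_2pin sin_int_2pin)
    qed
    then have "F (2 * pi * u) = F (2 * pi * frac u)" by (simp add: F_def)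
    moreover have "2 * pi * frac u \<in> {0..2 * pi}"
      using frac_lt_1[of u] by (auto simp: frac_ge_0 mult_left_le)
    ultimately show ?thesis
      using D[of "2 * pi * frac u"] by (simp add: D_def power2_eq_square algebra_simps)
  qed
  have "(\<lambda>n. cos (real n * (2 * pi * u)) / (real n)\<^sup>2 - cos (real n * (2 * pi * v)) / (real n)\<^sup>2)
      sums (F (2 * pi * u) - F (2 * pi * v))"
    unfolding F_def by (intro sums_diff summable_sums summ)
  also have "F (2 * pi * u) - F (2 * pi * v)
      = pi\<^sup>2 * (((frac u)\<^sup>2 - frac u) - ((frac v)\<^sup>2 - frac v))"
    by (simp only: per right_diff_distrib)
  finally show ?thesis by (simp only: diff_divide_distrib)
qed

section \<open>From exponential sums to sums of the sawtooth function\<close>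

definition psi :: "real \<Rightarrow> real" where
  "psi u = frac u - 1 / 2"

text \<open>
  The second periodic Bernoulli polynomial without its constant term \<open>1/6\<close>.
\<close>
definition bern :: "real \<Rightarrow> real" where
  "bern u = (frac u)\<^sup>2 - frac u"

lemma abs_psi_le: "\<bar>psi u\<bar> \<le> 1 / 2"
  using frac_lt_1[of u] frac_ge_0[of u] unfolding psi_def by linarith

text \<open>
  As \<open>bern / 2\<close> is a primitive of \<open>psi\<close>, the quotient is the mean of \<open>psi\<close> over \<open>[u - D, u]\<close>. The graph of
  \<open>psi\<close> has slope \<open>1\<close> and only jumps downwards, so \<open>psi\<close> at \<open>u - t\<close> is at least \<open>psi u - t\<close>.
\<close>
lemma psi_le_smoothed:
  assumes "0 < D" "D \<le> 1"
  shows "psi u \<le> (bern u - bern (u - D)) / (2 * D) + D / 2"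
proof (cases "D \<le> frac u")
  case True
  then have v: "frac (u - D) = frac u - D"
    using assms frac_lt_1[of u] by (subst frac_unique_iff) (auto simp: frac_def algebra_simps)
  show ?thesis
    unfolding psi_def bern_def v using assms by (simp add: field_simps power2_eq_square)
next
  case False
  have "u - D - (frac u - D + 1) = of_int (\<lfloor>u\<rfloor> - 1)" by (simp add: frac_def)
  then have "u - D - (frac u - D + 1) \<in> \<int>" by (simp only: Ints_of_int)
  moreover have "0 \<le> frac u - D + 1" using assms frac_ge_0[of u] by linarith
  ultimately have v: "frac (u - D) = frac u - D + 1"
    using False by (subst frac_unique_iff) auto
  have "(bern u - bern (u - D)) / (2 * D) + D / 2 - psi u = (D - frac u) / D"
    unfolding psi_def bern_def v using assms by (simp add: field_simps power2_eq_square)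
  moreover have "(D - frac u) / D \<ge> 0" using False assms by simp
  ultimately show ?thesis by linarith
qed

text \<open>
  The counterpart of \<open>psi_le_smoothed\<close>, with the mean over \<open>[u, u + D]\<close>.
\<close>
lemma psi_ge_smoothed:
  assumes "0 < D" "D \<le> 1"
  shows "(bern (u + D) - bern u) / (2 * D) - D / 2 \<le> psi u"
proof (cases "frac u + D < 1")
  case True
  have "u + D - (frac u + D) = of_int \<lfloor>u\<rfloor>" by (simp add: frac_def)
  then have "u + D - (frac u + D) \<in> \<int>" by (simp only: Ints_of_int)
  then have v: "frac (u + D) = frac u + D"
    using assms True frac_ge_0[of u] by (subst frac_unique_iff) auto
  show ?thesis
    unfolding psi_def bern_def v using assms by (simp add: field_simps power2_eq_square)
next
  case False
  have "u + D - (frac u + D - 1) = of_int (\<lfloor>u\<rfloor> + 1)" by (simp add: frac_def)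
  then have "u + D - (frac u + D - 1) \<in> \<int>" by (simp only: Ints_of_int)
  then have v: "frac (u + D) = frac u + D - 1"
    using assms False frac_lt_1[of u] by (subst frac_unique_iff) auto
  have "psi u - ((bern (u + D) - bern u) / (2 * D) - D / 2) = (D + frac u - 1) / D"
    unfolding psi_def bern_def v using assms by (simp add: field_simps power2_eq_square)
  moreover have "(D + frac u - 1) / D \<ge> 0" using False assms by simp
  ultimately show ?thesis by linarith
qed

lemma sum_inverse_sqrt_le: "(\<Sum>k=1..K. 1 / sqrt (real k)) \<le> 2 * sqrt (real K)"
proof (induction K)
  case (Suc K)
  define a b where "a = sqrt (real K)" and "b = sqrt (real (Suc K))"
  have ab: "0 \<le> a" "a < b" "b\<^sup>2 = a\<^sup>2 + 1" by (auto simp: a_def b_def)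
  have "(2 * b - 2 * a) * b - 1 = (b - a)\<^sup>2"
    using ab(3) by (simp add: power2_eq_square algebra_simps)
  then have "1 \<le> (2 * b - 2 * a) * b" by (smt (verit) zero_le_power2)
  then have "1 / b \<le> 2 * b - 2 * a" using ab by (simp add: divide_le_eq)
  then show ?case using Suc by (simp add: a_def b_def)
qed simp

lemma sum_inverse_power_three_halves_le:
  assumes "1 \<le> K" "K \<le> m"
  shows "(\<Sum>k=Suc K..m. 1 / (real k * sqrt (real k))) \<le> 2 / sqrt (real K) - 2 / sqrt (real m)"
  using assms(2)
proof (induction m rule: dec_induct)
  case (step m)
  define a b where "a = sqrt (real m)" and "b = sqrt (real (Suc m))"
  have ab: "0 < a" "a < b" "b\<^sup>2 = a\<^sup>2 + 1" using step assms by (auto simp: a_def b_def)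
  have "2 / a - 2 / b = 2 * (b - a) / (a * b)" using ab by (simp add: field_simps)
  also have "\<dots> = 2 * ((b - a) * (b + a)) / (a * b * (b + a))" using ab by simp
  also have "(b - a) * (b + a) = 1" using ab by (simp add: power2_eq_square algebra_simps)
  finally have "2 / a - 2 / b = 2 * 1 / (a * b * (b + a))" .
  moreover have "2 * 1 / (a * b * (b + a)) \<ge> 2 * 1 / (b * b * (b + b))"
    using ab by (intro divide_left_mono mult_mono add_mono mult_pos_pos add_pos_pos) auto
  moreover have "2 * 1 / (b * b * (b + b)) = 1 / (b\<^sup>2 * b)"
    using ab by (simp add: power2_eq_square flip: mult_2)
  moreover have "b\<^sup>2 = real (Suc m)" by (simp add: b_def)
  ultimately have "1 / (real (Suc m) * sqrt (real (Suc m))) \<le> 2 / a - 2 / b" by (simp add: b_def)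
  then show ?case using step by (simp add: a_def b_def)
qed simp

text \<open>
  The minimum bounds \<open>norm (e1 (k s) - e1 (k t))\<close> for \<open>\<bar>s - t\<bar> = 1/K\<close>. Divided by \<open>k\<^sup>2\<close>, as in the Fourier series, it is paired
  here with the terms of order \<open>sqrt k\<close> and \<open>1 / sqrt k\<close> in the bound for the \<open>k\<close>-th exponential sum. In the first sum
  the terms with \<open>k \<le> K\<close> and those with \<open>k > K\<close> have the same order of magnitude in total.
\<close>
lemma sum_min_le:
  assumes K: "1 \<le> K"
  shows "(\<Sum>k=1..m. min 2 (2 * pi * (real k / real K)) / (real k * sqrt (real k)))
           \<le> (4 * pi + 4) / sqrt (real K)" (is "?A \<le> _")
    and "(\<Sum>k=1..m. min 2 (2 * pi * (real k / real K)) / ((real k)\<^sup>2 * sqrt (real k)))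
           \<le> 6 * pi / real K" (is "?B \<le> _")
proof -
  let ?g = "\<lambda>k. min 2 (2 * pi * (real k / real K))"
  \<comment> \<open>splitting at \<open>K\<close> requires a range that reaches beyond \<open>K\<close>\<close>
  define M where "M = max m K"
  have sq: "sqrt (real K) * sqrt (real K) = real K" by simp
  have "?A \<le> (\<Sum>k=1..M. ?g k / (real k * sqrt (real k)))"
    by (rule sum_mono2) (auto simp: M_def)
  also have "{1..M} = {1..K} \<union> {Suc K..M}" using K by (auto simp: M_def)
  also have "(\<Sum>k\<in>{1..K} \<union> {Suc K..M}. ?g k / (real k * sqrt (real k)))
      = (\<Sum>k=1..K. ?g k / (real k * sqrt (real k))) + (\<Sum>k=Suc K..M. ?g k / (real k * sqrt (real k)))"
    by (rule sum.union_disjoint) auto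
  also have "(\<Sum>k=1..K. ?g k / (real k * sqrt (real k))) \<le> (\<Sum>k=1..K. 2 * pi / real K * (1 / sqrt (real k)))"
  proof (rule sum_mono)
    fix k assume "k \<in> {1..K}"
    then have "?g k / (real k * sqrt (real k)) \<le> (2 * pi * (real k / real K)) / (real k * sqrt (real k))"
      by (intro divide_right_mono) auto
    also have "\<dots> = 2 * pi / real K * (1 / sqrt (real k))" using \<open>k \<in> _\<close> by simp
    finally show "?g k / (real k * sqrt (real k)) \<le> 2 * pi / real K * (1 / sqrt (real k))" .
  qed
  also have "\<dots> = 2 * pi / real K * (\<Sum>k=1..K. 1 / sqrt (real k))" by (simp add: sum_distrib_left)
  also have "\<dots> \<le> 2 * pi / real K * (2 * sqrt (real K))"
    by (intro mult_left_mono sum_inverse_sqrt_le) auto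
  also have "\<dots> = 4 * pi / sqrt (real K)" using K sq by (simp add: field_simps)
  also have "(\<Sum>k=Suc K..M. ?g k / (real k * sqrt (real k))) \<le> (\<Sum>k=Suc K..M. 2 * (1 / (real k * sqrt (real k))))"
    by (rule sum_mono) (simp add: divide_right_mono)
  also have "\<dots> = 2 * (\<Sum>k=Suc K..M. 1 / (real k * sqrt (real k)))" by (simp add: sum_distrib_left)
  also have "\<dots> \<le> 2 * (2 / sqrt (real K) - 2 / sqrt (real M))"
    using K by (intro mult_left_mono sum_inverse_power_three_halves_le) (auto simp: M_def)
  also have "\<dots> \<le> 4 / sqrt (real K)" by simp
  finally show "?A \<le> (4 * pi + 4) / sqrt (real K)" by (simp add: add_divide_distrib)
  have three: "(\<Sum>k=1..m. 1 / (real k * sqrt (real k))) \<le> 3"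
  proof (cases "m = 0")
    case False
    then have "(\<Sum>k=1..m. 1 / (real k * sqrt (real k))) = 1 + (\<Sum>k=Suc 1..m. 1 / (real k * sqrt (real k)))"
      by (subst sum.atLeast_Suc_atMost) auto
    also have "(\<Sum>k=Suc 1..m. 1 / (real k * sqrt (real k))) \<le> 2 / sqrt (real 1) - 2 / sqrt (real m)"
      using False by (intro sum_inverse_power_three_halves_le) auto
    also have "\<dots> \<le> 2" by simp
    finally show ?thesis by simp
  qed simp
  have "?B \<le> (\<Sum>k=1..m. 2 * pi / real K * (1 / (real k * sqrt (real k))))"
  proof (rule sum_mono)
    fix k assume "k \<in> {1..m}"
    then have "?g k / ((real k)\<^sup>2 * sqrt (real k)) \<le> (2 * pi * (real k / real K)) / ((real k)\<^sup>2 * sqrt (real k))"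
      by (intro divide_right_mono) auto
    also have "\<dots> = 2 * pi / real K * (1 / (real k * sqrt (real k)))"
      using \<open>k \<in> _\<close> by (simp add: power2_eq_square)
    finally show "?g k / ((real k)\<^sup>2 * sqrt (real k)) \<le> 2 * pi / real K * (1 / (real k * sqrt (real k)))" .
  qed
  also have "\<dots> = 2 * pi / real K * (\<Sum>k=1..m. 1 / (real k * sqrt (real k)))"
    by (simp add: sum_distrib_left)
  also have "\<dots> \<le> 2 * pi / real K * 3"
    by (intro mult_left_mono three) auto
  finally show "?B \<le> 6 * pi / real K" by (simp add: mult_ac)
qed

lemma norm_e1_diff_le: "norm (e1 s - e1 t) \<le> min 2 (2 * pi * \<bar>s - t\<bar>)"
proof -
  have "e1 s = e1 t * e1 (s - t)" by (simp flip: e1_add)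
  then have "e1 s - e1 t = e1 t * (e1 (s - t) - 1)" by (simp add: algebra_simps)
  then have "norm (e1 s - e1 t) = 2 * \<bar>sin (pi * (s - t))\<bar>"
    by (simp add: norm_mult norm_e1_minus_1)
  moreover have "\<bar>sin (pi * (s - t))\<bar> \<le> 1" by simp
  moreover have "\<bar>sin (pi * (s - t))\<bar> \<le> pi * \<bar>s - t\<bar>"
    using abs_sin_x_le_abs_x[of "pi * (s - t)"] by (simp add: abs_mult)
  ultimately show ?thesis by simp
qed

text \<open>
  By \<open>fourier_frac_square\<close> the left side is a series over frequencies \<open>k\<close>, whose terms are at most
  \<open>norm (e1 (k s) - e1 (k t)) / k\<^sup>2\<close> times the \<open>k\<close>-th exponential sum. It is enough to bound the partial sums.
\<close>
lemma bern_difference_sum_le: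
  fixes f :: "nat \<Rightarrow> real"
  assumes st: "\<bar>s - t\<bar> = 1 / real K" and K: "1 \<le> K" and QR: "0 \<le> Q" "0 \<le> R"
    and S: "\<And>k. 1 \<le> k \<Longrightarrow>
      norm (\<Sum>n\<in>X. e1 (real k * f n)) \<le> Q * sqrt (real k) + R / sqrt (real k)"
  shows "\<bar>\<Sum>n\<in>X. (bern (f n + s) - bern (f n + t)) \<bar> \<le> 2 / real K * (Q * sqrt (real K) + R)"
proof -
  define u where "u k = (\<Sum>n\<in>X. (cos (real k * (2 * pi * (f n + s))) - cos (real k * (2 * pi * (f n + t))))
                                    / (real k)\<^sup>2)" for k
  let ?g = "\<lambda>k. min 2 (2 * pi * (real k / real K))"
  have sums: "u sums (\<Sum>n\<in>X. pi\<^sup>2 * (bern (f n + s) - bern (f n + t)))"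
    unfolding u_def bern_def by (intro sums_sum fourier_frac_square)
  have u_eq: "u k = Re ((e1 (real k * s) - e1 (real k * t)) * (\<Sum>n\<in>X. e1 (real k * f n))) / (real k)\<^sup>2" for k
  proof -
    have "(e1 (real k * s) - e1 (real k * t)) * (\<Sum>n\<in>X. e1 (real k * f n))
        = (\<Sum>n\<in>X. e1 (real k * (f n + s)) - e1 (real k * (f n + t)))"
      by (simp add: sum_distrib_left e1_add ring_distribs mult.commute sum_subtractf)
    then show ?thesis
      by (simp add: u_def e1_def sum_divide_distrib mult_ac)
  qed
  have u_le: "\<bar>u k\<bar> \<le> Q * (?g k / (real k * sqrt (real k))) + R * (?g k / ((real k)\<^sup>2 * sqrt (real k)))"
    if k: "1 \<le> k" for k
  proof -
    have "real k * s - real k * t = real k * (s - t)" by (simp add: algebra_simps)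
    then have e: "norm (e1 (real k * s) - e1 (real k * t)) \<le> ?g k"
      using norm_e1_diff_le[of "real k * s" "real k * t"] st by (simp add: abs_mult)
    have "\<bar>u k\<bar> \<le> norm ((e1 (real k * s) - e1 (real k * t)) * (\<Sum>n\<in>X. e1 (real k * f n))) / (real k)\<^sup>2"
      unfolding u_eq abs_divide abs_power2 by (intro divide_right_mono abs_Re_le_cmod) auto
    also have "\<dots> \<le> ?g k * (Q * sqrt (real k) + R / sqrt (real k)) / (real k)\<^sup>2"
      unfolding norm_mult by (intro divide_right_mono mult_mono e S k) auto
    also have "\<dots> = Q * (?g k * (sqrt (real k) / (real k)\<^sup>2)) + R * (?g k / ((real k)\<^sup>2 * sqrt (real k)))"
      by (simp add: add_divide_distrib ring_distribs mult_ac)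
    also have "sqrt (real k) / (real k)\<^sup>2 = 1 / (real k * sqrt (real k))"
      using k by (simp add: field_simps power2_eq_square)
    finally show ?thesis by simp
  qed
  have part: "\<bar>\<Sum>k<Suc m. u k\<bar> \<le> Q * ((4 * pi + 4) / sqrt (real K)) + R * (6 * pi / real K)" for m
  proof -
    have "(\<Sum>k<Suc m. u k) = (\<Sum>k=1..m. u k)"
    proof (rule sum.mono_neutral_right)
      show "\<forall>k\<in>{..<Suc m} - {1..m}. u k = 0"
        by (auto simp: u_def less_Suc_eq_le not_less_eq_eq)
    qed auto
    also have "\<bar>\<dots>\<bar> \<le> (\<Sum>k=1..m. \<bar>u k\<bar>)" by (rule sum_abs)
    also have "\<dots> \<le> (\<Sum>k=1..m. Q * (?g k / (real k * sqrt (real k))) + R * (?g k / ((real k)\<^sup>2 * sqrt (real k))))"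
      by (intro sum_mono u_le) auto
    also have "\<dots> = Q * (\<Sum>k=1..m. ?g k / (real k * sqrt (real k))) + R * (\<Sum>k=1..m. ?g k / ((real k)\<^sup>2 * sqrt (real k)))"
      by (simp only: sum.distrib sum_distrib_left)
    also have "\<dots> \<le> Q * ((4 * pi + 4) / sqrt (real K)) + R * (6 * pi / real K)"
      by (intro add_mono mult_left_mono sum_min_le K QR)
    finally show ?thesis .
  qed
  have "(\<lambda>m. \<bar>\<Sum>k<Suc m. u k\<bar>) \<longlonglongrightarrow> \<bar>\<Sum>n\<in>X. pi\<^sup>2 * (bern (f n + s) - bern (f n + t))\<bar>"
    using sums unfolding sums_def by (intro tendsto_rabs LIMSEQ_Suc)
  then have "\<bar>\<Sum>n\<in>X. pi\<^sup>2 * (bern (f n + s) - bern (f n + t))\<bar>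
      \<le> Q * ((4 * pi + 4) / sqrt (real K)) + R * (6 * pi / real K)"
    by (rule LIMSEQ_le_const2) (use part in blast)
  also have "\<dots> \<le> Q * (2 * pi\<^sup>2 / sqrt (real K)) + R * (2 * pi\<^sup>2 / real K)"
  proof (intro add_mono mult_left_mono divide_right_mono QR)
    \<comment> \<open>the Fourier coefficients carry \<open>1/\<pi>\<^sup>2\<close>, which absorbs the constants since \<open>\<pi> > 3\<close>\<close>
    have "3 * pi \<le> pi * pi" using pi_gt3 by (intro mult_right_mono) auto
    then show "6 * pi \<le> 2 * pi\<^sup>2" "4 * pi + 4 \<le> 2 * pi\<^sup>2"
      using pi_gt3 unfolding power2_eq_square by linarith+
  qed auto
  also have "\<dots> = pi\<^sup>2 * (2 / real K * (Q * (real K / sqrt (real K)) + R))"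
    using K by (simp add: field_simps)
  also have "real K / sqrt (real K) = sqrt (real K)" by (rule real_div_sqrt) simp
  finally have "pi\<^sup>2 * \<bar>\<Sum>n\<in>X. bern (f n + s) - bern (f n + t)\<bar>
      \<le> pi\<^sup>2 * (2 / real K * (Q * sqrt (real K) + R))"
    by (simp only: sum_distrib_left[symmetric] abs_mult abs_power2)
  then show ?thesis by (rule mult_left_le_imp_le) simp
qed

text \<open>
  The last term is the cost of replacing \<open>psi\<close> by its means over intervals of length \<open>1/K\<close>.
\<close>
lemma psi_sum_le_of_exp_sums:
  fixes f :: "nat \<Rightarrow> real"
  assumes K: "1 \<le> K" and QR: "0 \<le> Q" "0 \<le> R"
    and S: "\<And>k. 1 \<le> k \<Longrightarrow>
      norm (\<Sum>n\<in>X. e1 (real k * f n)) \<le> Q * sqrt (real k) + R / sqrt (real k)"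
  shows "\<bar>\<Sum>n\<in>X. psi (f n)\<bar> \<le> Q * sqrt (real K) + R + real (card X) / (2 * real K)"
proof -
  define D where "D = 1 / real K"
  have D: "0 < D" "D \<le> 1" using K by (auto simp: D_def)
  have half: "1 / (2 * D) * (2 / real K * z) = z" for z using K by (simp add: D_def)
  have "(\<Sum>n\<in>X. psi (f n)) \<le> (\<Sum>n\<in>X. 1 / (2 * D) * (bern (f n + 0) - bern (f n + (- D))) + D / 2)"
    using psi_le_smoothed[OF D] by (intro sum_mono) simp
  also have "\<dots> = 1 / (2 * D) * (\<Sum>n\<in>X. bern (f n + 0) - bern (f n + (- D))) + real (card X) * (D / 2)"
    by (simp only: sum.distrib sum_distrib_left sum_constant)
  also have "\<dots> \<le> 1 / (2 * D) * (2 / real K * (Q * sqrt (real K) + R)) + real (card X) * (D / 2)"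
    using D bern_difference_sum_le[OF _ K QR S, where s = 0 and t = "- D"]
    by (intro add_mono mult_left_mono) (auto simp: D_def)
  also have "\<dots> = Q * sqrt (real K) + R + real (card X) / (2 * real K)"
    unfolding half by (simp add: D_def)
  finally have up: "(\<Sum>n\<in>X. psi (f n)) \<le> Q * sqrt (real K) + R + real (card X) / (2 * real K)" .
  have "- (\<Sum>n\<in>X. psi (f n)) = (\<Sum>n\<in>X. - psi (f n))" by (simp add: sum_negf)
  also have "\<dots> \<le> (\<Sum>n\<in>X. 1 / (2 * D) * (bern (f n + 0) - bern (f n + D)) + D / 2)"
  proof (rule sum_mono)
    fix n
    show "- psi (f n) \<le> 1 / (2 * D) * (bern (f n + 0) - bern (f n + D)) + D / 2"
      using psi_ge_smoothed[OF D, of "f n"] by (simp add: diff_divide_distrib)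
  qed
  also have "\<dots> = 1 / (2 * D) * (\<Sum>n\<in>X. bern (f n + 0) - bern (f n + D)) + real (card X) * (D / 2)"
    by (simp only: sum.distrib sum_distrib_left sum_constant)
  also have "\<dots> \<le> 1 / (2 * D) * (2 / real K * (Q * sqrt (real K) + R)) + real (card X) * (D / 2)"
    using D bern_difference_sum_le[OF _ K QR S, where s = 0 and t = D]
    by (intro add_mono mult_left_mono) (auto simp: D_def)
  also have "\<dots> = Q * sqrt (real K) + R + real (card X) / (2 * real K)"
    unfolding half by (simp add: D_def)
  finally show ?thesis using up by linarith
qed

text \<open>
  The sequence \<open>k f\<close> has second differences of size \<open>k c\<^sup>3\<close>, so \<open>exp_sum_second_difference_test\<close> gives the
  hypothesis of \<open>psi_sum_le_of_exp_sums\<close> with \<open>Q\<close> of order \<open>(B - A) c powr (3/2)\<close> and \<open>R\<close> of order \<open>c powr (-3/2)\<close>. With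
  \<open>K \<approx> 1/c\<close> both \<open>Q sqrt K\<close> and the smoothing error are of order \<open>(B - A) c\<close>. For \<open>c > 1\<close> the bound is trivial.
\<close>
lemma psi_sum_second_difference_test:
  fixes f :: "nat \<Rightarrow> real"
  assumes c: "0 < c" and h: "1 \<le> h" and AB: "A \<le> B"
    and D2: "\<And>n. A \<le> n \<Longrightarrow> n < B \<Longrightarrow> c ^ 3 \<le> f (Suc (Suc n)) - 2 * f (Suc n) + f n"
            "\<And>n. A \<le> n \<Longrightarrow> n < B \<Longrightarrow> f (Suc (Suc n)) - 2 * f (Suc n) + f n \<le> h * c ^ 3"
  shows "\<bar>\<Sum>n=A..<B. psi (f n)\<bar> \<le> 11 * h * real (B - A) * c + 10 / sqrt (c ^ 3)"
proof (cases "c \<le> 1")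
  case False
  have "\<bar>\<Sum>n=A..<B. psi (f n)\<bar> \<le> (\<Sum>n=A..<B. 1 / 2)"
    by (rule order.trans[OF sum_abs sum_mono]) (rule abs_psi_le)
  also have "\<dots> \<le> 1 * real (B - A) * 1" by simp
  also have "\<dots> \<le> 11 * h * real (B - A) * c"
    using h False by (intro mult_mono) auto
  finally show ?thesis using c by (smt (verit) divide_nonneg_nonneg real_sqrt_ge_zero zero_le_power)
next
  case True
  define K where "K = nat \<lceil>1 / c\<rceil>"
  have Kge: "1 / c \<le> real K" unfolding K_def by (rule real_nat_ceiling_ge)
  have "1 \<le> 1 / c" using True c by simp
  then have K1: "1 \<le> K" using Kge by linarith
  have "real K \<le> 1 / c + 1" unfolding K_def using c by (simp add: of_nat_nat; linarith)
  also have "\<dots> \<le> 2 / c" using True c by (simp add: field_simps)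
  finally have Kle: "real K \<le> 2 / c" .
  define Q where "Q = 5 * h * real (B - A) * sqrt (c ^ 3)"
  define R where "R = 10 / sqrt (c ^ 3)"
  have QR: "0 \<le> Q" "0 \<le> R" using h c by (auto simp: Q_def R_def)
  have "\<bar>\<Sum>n=A..<B. psi (f n)\<bar> \<le> Q * sqrt (real K) + R + real (card {A..<B}) / (2 * real K)"
  proof (rule psi_sum_le_of_exp_sums[OF K1 QR])
    fix k :: nat assume k: "1 \<le> k"
    have "norm (\<Sum>n=A..<B. e1 (real k * f n))
        \<le> 5 * (h * real (B - A) * sqrt (real k * c ^ 3) + 2 / sqrt (real k * c ^ 3))"
    proof (rule exp_sum_second_difference_test[OF _ AB])
      show "0 < real k * c ^ 3" using k c by simp
      fix n assume n: "A \<le> n" "n < B"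
      have eq: "real k * f (Suc (Suc n)) - 2 * (real k * f (Suc n)) + real k * f n
          = real k * (f (Suc (Suc n)) - 2 * f (Suc n) + f n)" by (simp add: algebra_simps)
      show "real k * c ^ 3 \<le> real k * f (Suc (Suc n)) - 2 * (real k * f (Suc n)) + real k * f n"
        unfolding eq using D2(1)[OF n] by (intro mult_left_mono) auto
      have "real k * (f (Suc (Suc n)) - 2 * f (Suc n) + f n) \<le> real k * (h * c ^ 3)"
        using D2(2)[OF n] by (intro mult_left_mono) auto
      then show "real k * f (Suc (Suc n)) - 2 * (real k * f (Suc n)) + real k * f n \<le> h * (real k * c ^ 3)"
        unfolding eq by (simp add: mult_ac)
    qed
    also have "\<dots> = Q * sqrt (real k) + R / sqrt (real k)"
      by (simp add: Q_def R_def real_sqrt_mult algebra_simps)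
    finally show "norm (\<Sum>n=A..<B. e1 (real k * f n)) \<le> Q * sqrt (real k) + R / sqrt (real k)" .
  qed
  moreover have "Q * sqrt (real K) \<le> 10 * h * real (B - A) * c"
  proof -
    have "sqrt (c ^ 3) * sqrt (real K) = sqrt (c ^ 3 * real K)" by (simp add: real_sqrt_mult)
    also have "\<dots> \<le> sqrt (c ^ 3 * (2 / c))" using c Kle by (intro real_sqrt_le_mono mult_left_mono) auto
    also have "c ^ 3 * (2 / c) = 2 * c\<^sup>2" using c by (simp add: power3_eq_cube power2_eq_square)
    also have "sqrt (2 * c\<^sup>2) \<le> sqrt ((2 * c)\<^sup>2)"
      by (intro real_sqrt_le_mono) (simp add: power2_eq_square)
    also have "\<dots> = 2 * c" using c by (simp only: real_sqrt_abs)
    finally have "5 * h * real (B - A) * (sqrt (c ^ 3) * sqrt (real K)) \<le> 5 * h * real (B - A) * (2 * c)"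
      using h by (intro mult_left_mono) auto
    then show ?thesis by (simp add: Q_def mult_ac)
  qed
  moreover have "real (card {A..<B}) / (2 * real K) \<le> h * real (B - A) * c"
  proof -
    have "1 / (2 * real K) \<le> c"
      using Kge K1 c by (simp add: field_simps)
    then have "real (B - A) * (1 / (2 * real K)) \<le> (h * real (B - A)) * c"
      using h by (intro mult_mono) (auto simp: mult_le_cancel_right1)
    then show ?thesis by simp
  qed
  ultimately show ?thesis unfolding R_def by (simp add: algebra_simps)
qed

section \<open>The sawtooth function along a hyperbola\<close>

text \<open>
  The second difference of \<open>Y\<^sup>3 / x\<close> is \<open>2 Y\<^sup>3 / (x (x + 1) (x + 2))\<close>, and all three factors lie between \<open>N\<close> and \<open>4N\<close>.
  So \<open>psi_sum_second_difference_test\<close> applies with \<open>c = Y / (4N)\<close> and \<open>h = 128\<close>, and \<open>N c\<close> does not depend on \<open>N\<close>.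
  The variable \<open>Y\<close> stands for the cube root of \<open>y\<close>, which keeps fractional powers out of the computation.
\<close>
lemma psi_hyperbola_block:
  fixes Y a b :: real and N A B :: nat
  assumes Y: "1 \<le> Y" and a: "0 \<le> a" "a \<le> 1" and N: "1 \<le> N" "(real N)\<^sup>2 \<le> Y ^ 3"
    and AB: "N \<le> A" "A \<le> B" "B \<le> 2 * N"
  shows "\<bar>\<Sum>n=A..<B. psi (Y ^ 3 / (real n + a) - b)\<bar> \<le> 432 * Y"
proof -
  define c where "c = Y / (4 * real N)"
  have c: "0 < c" using Y N by (simp add: c_def)
  have c3: "c ^ 3 = Y ^ 3 / (64 * real N ^ 3)"
    by (simp add: c_def power_divide power_mult_distrib)
  have "\<bar>\<Sum>n=A..<B. psi (Y ^ 3 / (real n + a) - b)\<bar>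
      \<le> 11 * 128 * real (B - A) * c + 10 / sqrt (c ^ 3)"
  proof (rule psi_sum_second_difference_test[OF c _ AB(2)])
    fix n assume n: "A \<le> n" "n < B"
    define x where "x = real n + a"
    have x: "real N \<le> x" "x + 2 \<le> 4 * real N" using n AB a N by (auto simp: x_def)
    have x0: "0 < x" "0 < real N" using x N by auto
    have "Y ^ 3 / (x + 2) - 2 * (Y ^ 3 / (x + 1)) + Y ^ 3 / x = 2 * Y ^ 3 / (x * (x + 1) * (x + 2))"
      using x0 by (simp add: divide_simps) (simp add: algebra_simps)
    then have eq: "Y ^ 3 / (real (Suc (Suc n)) + a) - b - 2 * (Y ^ 3 / (real (Suc n) + a) - b)
        + (Y ^ 3 / (real n + a) - b) = 2 * Y ^ 3 / (x * (x + 1) * (x + 2))"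
      by (simp add: x_def algebra_simps)
    have "x * (x + 1) * (x + 2) \<le> (4 * real N) * (4 * real N) * (4 * real N)"
      using x x0 by (intro mult_mono) auto
    then have "Y ^ 3 / (64 * real N ^ 3) \<le> 2 * Y ^ 3 / (x * (x + 1) * (x + 2))"
      using x0 Y by (intro frac_le) (auto simp: power3_eq_cube)
    then show "c ^ 3 \<le> Y ^ 3 / (real (Suc (Suc n)) + a) - b - 2 * (Y ^ 3 / (real (Suc n) + a) - b)
        + (Y ^ 3 / (real n + a) - b)" unfolding eq c3 .
    have "real N * real N * real N \<le> x * (x + 1) * (x + 2)"
      using x x0 by (intro mult_mono) auto
    then have "2 * Y ^ 3 / (x * (x + 1) * (x + 2)) \<le> 2 * Y ^ 3 / (real N * real N * real N)"
      using x0 Y by (intro divide_left_mono) auto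
    also have "\<dots> = 128 * c ^ 3" unfolding c3 by (simp add: power3_eq_cube)
    finally show "Y ^ 3 / (real (Suc (Suc n)) + a) - b - 2 * (Y ^ 3 / (real (Suc n) + a) - b)
        + (Y ^ 3 / (real n + a) - b) \<le> 128 * c ^ 3" unfolding eq .
  qed simp
  moreover have "11 * 128 * real (B - A) * c \<le> 352 * Y"
  proof -
    have "real (B - A) \<le> real N" using AB by simp
    then have "real (B - A) * c \<le> real N * c" using c by (intro mult_right_mono) auto
    also have "\<dots> = Y / 4" using N by (simp add: c_def)
    finally have "1408 * (real (B - A) * c) \<le> 352 * Y" by linarith
    then show ?thesis by (simp only: mult.assoc)
  qed
  moreover have "10 / sqrt (c ^ 3) \<le> 80 * Y"
  proof -
    \<comment> \<open>\<open>N \<le> Y\<^sup>2\<close>, since \<open>N\<^sup>2 \<le> Y\<^sup>3 \<le> Y\<^sup>4\<close>; this is where \<open>n \<le> sqrt y\<close> enters\<close>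
    have "real N ^ 3 = real N * (real N)\<^sup>2" by (simp add: power3_eq_cube power2_eq_square)
    also have "\<dots> \<le> Y\<^sup>2 * Y ^ 3"
    proof (rule mult_mono)
      have "(real N)\<^sup>2 \<le> Y ^ 3" by (rule N)
      also have "\<dots> \<le> Y ^ 4" using Y by (intro power_increasing) auto
      also have "Y ^ 4 = (Y\<^sup>2)\<^sup>2" by simp
      finally show "real N \<le> Y\<^sup>2" by (rule power2_le_imp_le) simp
    qed (use N in auto)
    finally have "real N ^ 3 \<le> Y\<^sup>2 * Y ^ 3" .
    then have "1 / (64 * Y\<^sup>2) \<le> c ^ 3"
      unfolding c3 using Y N by (simp add: field_simps)
    then have "sqrt (1 / (64 * Y\<^sup>2)) \<le> sqrt (c ^ 3)" by (rule real_sqrt_le_mono)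
    moreover have "1 / (64 * Y\<^sup>2) = (1 / (8 * Y))\<^sup>2" by (simp add: power_divide power_mult_distrib)
    ultimately have s: "1 / (8 * Y) \<le> sqrt (c ^ 3)" using Y by (simp only: real_sqrt_abs)
    have "10 / sqrt (c ^ 3) \<le> 10 / (1 / (8 * Y))"
      using s Y c by (intro divide_left_mono) auto
    then show ?thesis by simp
  qed
  ultimately show ?thesis by linarith
qed

lemma psi_hyperbola_dyadic:
  fixes Y a b :: real
  assumes Y: "1 \<le> Y" and a: "0 \<le> a" "a \<le> 1"
    and M: "M \<le> 2 ^ j" "\<And>n. n < M \<Longrightarrow> (real n)\<^sup>2 \<le> Y ^ 3"
  shows "\<bar>\<Sum>n=1..<M. psi (Y ^ 3 / (real n + a) - b)\<bar> \<le> real j * (432 * Y)"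
  using M
proof (induction j arbitrary: M)
  case 0
  then show ?case by simp
next
  case (Suc j)
  show ?case
  proof (cases "M \<le> 2 ^ j")
    case True
    then have "\<bar>\<Sum>n=1..<M. psi (Y ^ 3 / (real n + a) - b)\<bar> \<le> real j * (432 * Y)"
      using Suc by auto
    also have "\<dots> \<le> real (Suc j) * (432 * Y)" using Y by (intro mult_right_mono) auto
    finally show ?thesis .
  next
    case False
    have "\<bar>\<Sum>n=1..<2 ^ j. psi (Y ^ 3 / (real n + a) - b)\<bar> \<le> real j * (432 * Y)"
      using Suc False by auto
    moreover have "\<bar>\<Sum>n=2 ^ j..<M. psi (Y ^ 3 / (real n + a) - b)\<bar> \<le> 432 * Y"
      using Suc.prems(1) Suc.prems(2)[of "2 ^ j"] False
      by (intro psi_hyperbola_block[OF Y a, where N = "2 ^ j"]) auto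
    moreover have "(\<Sum>n=1..<M. psi (Y ^ 3 / (real n + a) - b))
        = (\<Sum>n=1..<2 ^ j. psi (Y ^ 3 / (real n + a) - b)) + (\<Sum>n=2 ^ j..<M. psi (Y ^ 3 / (real n + a) - b))"
      using False by (intro sum.atLeastLessThan_concat[symmetric]) auto
    moreover have "real (Suc j) * (432 * Y) = real j * (432 * Y) + 432 * Y" by (simp add: algebra_simps)
    ultimately show ?thesis by linarith
  qed
qed

text \<open>
  About \<open>log 2 y\<close> dyadic blocks cover the range.
\<close>
lemma psi_hyperbola_sum:
  fixes y a b :: real
  assumes y: "1 \<le> y" and a: "0 \<le> a" "a \<le> 1" and N: "(real N)\<^sup>2 \<le> y"
  shows "\<bar>\<Sum>n=1..N. psi (y / (real n + a) - b)\<bar> \<le> 864 * (y powr (1 / 3) * (1 + ln y))"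
proof -
  define Y where "Y = y powr (1 / 3)"
  have Y: "1 \<le> Y" using y by (simp add: Y_def ge_one_powr_ge_zero)
  have Y3: "Y ^ 3 = y" using y by (simp add: Y_def powr_powr flip: powr_numeral)
  define j where "j = nat \<lceil>log 2 (real N + 1)\<rceil>"
  have "log 2 (real N + 1) \<le> real j" unfolding j_def by (rule real_nat_ceiling_ge)
  then have "real N + 1 \<le> 2 powr real j" by (subst (asm) log_le_iff) auto
  then have "real (Suc N) \<le> real (2 ^ j)" by (simp add: powr_realpow)
  then have "Suc N \<le> 2 ^ j" by (simp only: of_nat_le_iff)
  moreover have "(real n)\<^sup>2 \<le> Y ^ 3" if "n < Suc N" for n
  proof -
    have "(real n)\<^sup>2 \<le> (real N)\<^sup>2" using that by (intro power_mono) auto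
    then show ?thesis using N unfolding Y3 by linarith
  qed
  ultimately have "\<bar>\<Sum>n=1..<Suc N. psi (Y ^ 3 / (real n + a) - b)\<bar> \<le> real j * (432 * Y)"
    by (intro psi_hyperbola_dyadic Y a)
  then have "\<bar>\<Sum>n=1..N. psi (y / (real n + a) - b)\<bar> \<le> real j * (432 * Y)"
    by (simp only: atLeastLessThanSuc_atLeastAtMost Y3)
  moreover have "real j \<le> 2 * (1 + ln y)"
  proof -
    have "real N \<le> (real N)\<^sup>2" by (simp add: power2_eq_square flip: of_nat_mult)
    then have "real N + 1 \<le> 2 * y" using N y by linarith
    then have "log 2 (real N + 1) \<le> log 2 (2 * y)" using y by (subst log_le_cancel_iff) auto
    also have "\<dots> = 1 + ln y / ln 2" using y by (simp add: log_def ln_mult add_divide_distrib)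
    also have "ln y / ln 2 \<le> ln y / (1 / 2)"
      using y ln2_ge_two_thirds by (intro divide_left_mono) auto
    finally have "log 2 (real N + 1) \<le> 1 + 2 * ln y" by simp
    moreover have "0 \<le> log 2 (real N + 1)" by simp
    ultimately show ?thesis unfolding j_def by (simp add: of_nat_nat; linarith)
  qed
  then have "real j * (432 * Y) \<le> 2 * (1 + ln y) * (432 * Y)"
    using Y by (intro mult_right_mono) auto
  ultimately have "\<bar>\<Sum>n=1..N. psi (y / (real n + a) - b)\<bar> \<le> 2 * (1 + ln y) * (432 * Y)"
    by linarith
  then show ?thesis by (simp add: Y_def algebra_simps)
qed

lemma card_nat_interval:
  assumes "0 \<le> v" "v \<le> u"
  shows "finite {k::nat. v < real k \<and> real k \<le> u}"
    and "real (card {k::nat. v < real k \<and> real k \<le> u}) = u - v - psi u + psi v"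
proof -
  have iff: "v < real k \<and> real k \<le> u \<longleftrightarrow> k \<in> {nat \<lfloor>v\<rfloor><..nat \<lfloor>u\<rfloor>}" for k :: nat
  proof -
    have "v < real k \<longleftrightarrow> nat \<lfloor>v\<rfloor> < k"
    proof -
      have "v < real k \<longleftrightarrow> \<lfloor>v\<rfloor> < int k" by (simp add: floor_less_iff)
      also have "\<dots> \<longleftrightarrow> nat \<lfloor>v\<rfloor> < k" using assms by (simp add: nat_less_iff)
      finally show ?thesis .
    qed
    moreover have "real k \<le> u \<longleftrightarrow> k \<le> nat \<lfloor>u\<rfloor>"
      using assms by (simp add: le_nat_iff le_floor_iff)
    ultimately show ?thesis by auto
  qed
  have set: "{k::nat. v < real k \<and> real k \<le> u} = {nat \<lfloor>v\<rfloor><..nat \<lfloor>u\<rfloor>}"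
    unfolding iff by auto
  show "finite {k::nat. v < real k \<and> real k \<le> u}" unfolding set by simp
  have "nat \<lfloor>v\<rfloor> \<le> nat \<lfloor>u\<rfloor>" using assms by (intro nat_mono floor_mono)
  then have "real (nat \<lfloor>u\<rfloor> - nat \<lfloor>v\<rfloor>) = of_int \<lfloor>u\<rfloor> - of_int \<lfloor>v\<rfloor>"
    using assms by (simp add: of_nat_diff)
  then show "real (card {k::nat. v < real k \<and> real k \<le> u}) = u - v - psi u + psi v"
    unfolding set by (simp add: psi_def frac_def)
qed

text \<open>
  Equal to \<open>Digamma (a + 1) - Digamma 1\<close>.
\<close>
definition shift_series :: "real \<Rightarrow> real" where
  "shift_series a = (\<Sum>k. 1 / real (Suc k) - 1 / (real (Suc k) + a))"

text \<open>
  A term is \<open>a / ((k + 1) (k + 1 + a))\<close>; as \<open>k \<le> k + 1 + a \<le> k + 2\<close>, it lies between the terms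
  of two telescoping series.
\<close>
lemma shift_series_term_bounds:
  assumes a: "0 < a" "a \<le> 1"
  shows "a * (1 / (real k + 1) - 1 / (real k + 2)) \<le> 1 / real (Suc k) - 1 / (real (Suc k) + a)"
    and "0 < k \<Longrightarrow> 1 / real (Suc k) - 1 / (real (Suc k) + a) \<le> a * (1 / real k - 1 / (real k + 1))"
    and "1 / real (Suc k) - 1 / (real (Suc k) + a) \<le> a * (1 / (real (Suc k))\<^sup>2)"
proof -
  have eq: "1 / real (Suc k) - 1 / (real (Suc k) + a) = a * (1 / ((real k + 1) * (real k + 1 + a)))"
    using a by (simp add: field_simps)
  have "1 / ((real k + 1) * (real k + 2)) \<le> 1 / ((real k + 1) * (real k + 1 + a))"
    using a by (intro divide_left_mono mult_left_mono) auto
  moreover have "1 / (real k + 1) - 1 / (real k + 2) = 1 / ((real k + 1) * (real k + 2))"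
    by (simp add: field_simps)
  ultimately show "a * (1 / (real k + 1) - 1 / (real k + 2)) \<le> 1 / real (Suc k) - 1 / (real (Suc k) + a)"
    unfolding eq using a by (intro mult_left_mono) auto
  have le: "1 / ((real k + 1) * (real k + 1 + a)) \<le> 1 / ((real k + 1) * z)"
    if "0 < z" "z \<le> real k + 1" for z
    using a that by (intro divide_left_mono mult_left_mono) auto
  show "1 / real (Suc k) - 1 / (real (Suc k) + a) \<le> a * (1 / real k - 1 / (real k + 1))" if k: "0 < k"
  proof -
    have "1 / real k - 1 / (real k + 1) = 1 / ((real k + 1) * real k)"
      using k by (simp add: field_simps)
    then show ?thesis unfolding eq using a k le[of "real k"] by (intro mult_left_mono) auto
  qed
  show "1 / real (Suc k) - 1 / (real (Suc k) + a) \<le> a * (1 / (real (Suc k))\<^sup>2)"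
    unfolding eq using a le[of "real k + 1"] by (intro mult_left_mono) (auto simp: power2_eq_square add.commute)
qed

lemma summable_shift_series:
  assumes a: "0 < a" "a \<le> 1"
  shows "summable (\<lambda>k. 1 / real (Suc k) - 1 / (real (Suc k) + a))"
proof (rule summable_comparison_test')
  show "summable (\<lambda>k. a * (1 / (real (Suc k))\<^sup>2))"
    using summable_inverse_square by (intro summable_mult) (subst summable_Suc_iff)
  fix k
  have "0 \<le> 1 / real (Suc k) - 1 / (real (Suc k) + a)"
    using a by (simp add: field_simps)
  then show "norm (1 / real (Suc k) - 1 / (real (Suc k) + a)) \<le> a * (1 / (real (Suc k))\<^sup>2)"
    using shift_series_term_bounds(3)[OF a] by simp
qed

lemma shift_series_bounds:
  assumes a: "0 < a" "a \<le> 1"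
  shows "0 \<le> shift_series a" "shift_series a \<le> 2 * a"
    and "0 < N \<Longrightarrow> a / (real N + 1) \<le> shift_series a - (\<Sum>k<N. 1 / real (Suc k) - 1 / (real (Suc k) + a))"
    and "0 < N \<Longrightarrow> shift_series a - (\<Sum>k<N. 1 / real (Suc k) - 1 / (real (Suc k) + a)) \<le> a / real N"
proof -
  let ?t = "\<lambda>k. 1 / real (Suc k) - 1 / (real (Suc k) + a)"
  have nonneg: "0 \<le> ?t k" for k using a by (simp add: field_simps)
  show "0 \<le> shift_series a"
    unfolding shift_series_def by (intro suminf_nonneg summable_shift_series a nonneg)
  have tail: "shift_series a - (\<Sum>k<N. ?t k) = (\<Sum>k. ?t (k + N))" for N
    unfolding shift_series_def using suminf_split_initial_segment[OF summable_shift_series[OF a], of N]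
    by simp
  have summ: "summable (\<lambda>k. ?t (k + N))" for N
    by (rule summable_ignore_initial_segment[OF summable_shift_series[OF a]])
  have tel: "(\<lambda>k. a * (1 / real (k + M) - 1 / real (Suc k + M))) sums (a / real M)" for M
  proof -
    have "(\<lambda>k. 1 / real (k + M)) \<longlonglongrightarrow> 0"
      by (rule LIMSEQ_ignore_initial_segment[OF lim_1_over_n])
    from sums_mult[OF telescope_sums'[OF this], of a] show ?thesis by simp
  qed
  show lower: "a / (real N + 1) \<le> shift_series a - (\<Sum>k<N. ?t k)" for N
    unfolding tail
  proof -
    have "a / real (N + 1) \<le> (\<Sum>k. ?t (k + N))"
    proof (rule sums_le[OF _ tel summable_sums[OF summ]])
      show "a * (1 / real (k + (N + 1)) - 1 / real (Suc k + (N + 1))) \<le> ?t (k + N)" for k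
        using shift_series_term_bounds(1)[OF a, of "k + N"] by (simp add: add_ac)
    qed
    then show "a / (real N + 1) \<le> (\<Sum>k. ?t (k + N))" by (simp add: add.commute)
  qed
  show upper: "shift_series a - (\<Sum>k<N. ?t k) \<le> a / real N" if "0 < N" for N
  proof -
    have "(\<Sum>k. ?t (k + N)) \<le> a / real N"
    proof (rule sums_le[OF _ summable_sums[OF summ] tel])
      show "?t (k + N) \<le> a * (1 / real (k + N) - 1 / real (Suc k + N))" for k
        using shift_series_term_bounds(2)[OF a, of "k + N"] that by (simp add: add_ac)
    qed
    then show ?thesis unfolding tail by simp
  qed
  have "?t 0 \<le> a" using shift_series_term_bounds(3)[OF a, of 0] by simp
  then show "shift_series a \<le> 2 * a" using upper[of 1] by simp
qed

section \<open>Lattice points between two hyperbolas\<close>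

text \<open>
  With \<open>N = \<lfloor>sqrt y\<rfloor>\<close>, every pair has \<open>m \<le> N\<close> or \<open>n \<le> N\<close>. Both conditions hold for at most one pair,
  \<open>(N, N)\<close>, because \<open>N\<^sup>2 \<le> y < (m + 1) n\<close>. For fixed \<open>n \<le> N\<close> the number of \<open>m\<close> is \<open>a\<close> up to two values
  of \<open>psi\<close>, and for fixed \<open>m \<le> N\<close> the number of \<open>n\<close> is \<open>y (1/m - 1/(m + a))\<close> up to two values of \<open>psi\<close>. The
  total \<open>a N\<close> of the first kind matches the part of the series beyond \<open>N\<close>, as \<open>y\<close> is close to \<open>N\<^sup>2\<close>.
\<close>
lemma hyperbola_pair_count:
  fixes y a :: real
  assumes y: "1 \<le> y" and a: "0 < a" "a \<le> 1"
  defines "P \<equiv> {(m::nat, n::nat). 1 \<le> m \<and> 1 \<le> n \<and> real m * real n \<le> y \<and> y < (real m + a) * real n}"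
  shows "\<bar>real (card P) - y * shift_series a\<bar> \<le> 3460 * (y powr (1 / 3) * (1 + ln y))"
proof -
  define N where "N = nat \<lfloor>sqrt y\<rfloor>"
  have "real N \<le> sqrt y" using y unfolding N_def by simp
  then have N2: "(real N)\<^sup>2 \<le> y" using y by (metis of_nat_0_le_iff power_mono real_sqrt_pow2 order.trans zero_le_one)
  have "sqrt y < real N + 1" using y unfolding N_def by (simp; linarith)
  then have yN: "y < (real N + 1)\<^sup>2" using y by (metis real_sqrt_less_iff real_sqrt_abs abs_of_nonneg add_nonneg_nonneg of_nat_0_le_iff zero_le_one)
  have "1 \<le> sqrt y" using y by simp
  then have N1: "1 \<le> N" unfolding N_def by (simp add: le_nat_iff le_floor_iff)
  define E where "E = 864 * (y powr (1 / 3) * (1 + ln y))"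
  define S where "S = (SIGMA n:{1..N}. {m::nat. y / real n - a < real m \<and> real m \<le> y / real n})"
  define T where "T = (SIGMA m:{1..N}. {n::nat. y / (real m + a) < real n \<and> real n \<le> y / real m})"
  have ok1: "0 \<le> y / real n - a" if "n \<in> {1..N}" for n
  proof -
    have "a * real n \<le> 1 * real N" using that a by (intro mult_mono) auto
    also have "\<dots> \<le> real N * real N" using N1 by (intro mult_right_mono) auto
    also have "\<dots> \<le> y" using N2 by (simp add: power2_eq_square)
    finally show ?thesis using that by (simp add: field_simps)
  qed
  have ok2: "0 \<le> y / (real m + a)" "y / (real m + a) \<le> y / real m" if "m \<in> {1..N}" for m
    using that a y by (auto intro!: divide_left_mono)
  have finS: "finite S" unfolding S_def using ok1 a by (intro finite_SigmaI card_nat_interval(1)) auto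
  have finT: "finite T" unfolding T_def using ok2 by (intro finite_SigmaI card_nat_interval(1)) auto
  have inS: "(n, m) \<in> S \<longleftrightarrow> (m, n) \<in> P \<and> n \<le> N" for m n
  proof (cases "n \<in> {1..N}")
    case True
    then have "y / real n - a < real m \<longleftrightarrow> y < (real m + a) * real n"
      "real m \<le> y / real n \<longleftrightarrow> real m * real n \<le> y" by (auto simp: field_simps)
    moreover have "y / real n - a < real m \<Longrightarrow> 1 \<le> m" using ok1[OF True] by linarith
    ultimately show ?thesis using True by (auto simp: S_def P_def)
  qed (auto simp: S_def P_def)
  have inT: "(m, n) \<in> T \<longleftrightarrow> (m, n) \<in> P \<and> m \<le> N" for m n
  proof (cases "m \<in> {1..N}")
    case True
    then have "y / (real m + a) < real n \<longleftrightarrow> y < (real m + a) * real n"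
      "real n \<le> y / real m \<longleftrightarrow> real m * real n \<le> y" using a by (auto simp: field_simps)
    moreover have "y / (real m + a) < real n \<Longrightarrow> 1 \<le> n" using ok2[OF True] by linarith
    ultimately show ?thesis using True by (auto simp: T_def P_def)
  qed (auto simp: T_def P_def)
  have cover: "m \<le> N \<or> n \<le> N" if "(m, n) \<in> P" for m n
  proof (rule ccontr)
    assume "\<not> (m \<le> N \<or> n \<le> N)"
    then have "(real N + 1) * (real N + 1) \<le> real m * real n" by (intro mult_mono) auto
    with that yN show False by (auto simp: P_def power2_eq_square)
  qed
  have P: "P = prod.swap ` S \<union> T"
  proof (intro equalityI subrelI)
    fix m n assume "(m, n) \<in> P"
    with cover inS inT have "(n, m) \<in> S \<or> (m, n) \<in> T" by blast
    then show "(m, n) \<in> prod.swap ` S \<union> T" by force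
  qed (use inS inT in auto)
  have PST: "prod.swap ` S \<inter> T \<subseteq> {(N, N)}"
  proof clarsimp
    fix n m assume "(n, m) \<in> S" "(m, n) \<in> T"
    then have mn: "m \<le> N" "n \<le> N" "y < (real m + a) * real n" using inS inT by (auto simp: P_def)
    have "(real m + a) * real n \<le> (real m + 1) * real n" using a by (intro mult_right_mono) auto
    then have "(real N)\<^sup>2 < (real m + 1) * real n" using mn N2 by linarith
    then have "real (N * N) < real ((m + 1) * n)" by (simp add: power2_eq_square algebra_simps)
    then have lt: "N * N < (m + 1) * n" by (simp only: of_nat_less_iff)
    have "m = N"
    proof (rule ccontr)
      assume "m \<noteq> N"
      then have "(m + 1) * n \<le> N * N" using mn by (intro mult_le_mono) auto
      with lt show False by simp
    qed
    moreover have "n = N"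
    proof (rule ccontr)
      assume "n \<noteq> N"
      then have "(m + 1) * n \<le> (N + 1) * (N - 1)" using mn by (intro mult_le_mono) auto
      also have "\<dots> \<le> N * N" by (cases N) auto
      finally show False using lt by simp
    qed
    ultimately show "m = N \<and> n = N" by simp
  qed
  have "card (prod.swap ` S) + card T = card P + card (prod.swap ` S \<inter> T)"
    unfolding P using finS finT by (intro card_Un_Int) auto
  moreover have "card (prod.swap ` S) = card S"
    by (intro card_image inj_onI) (metis swap_swap)
  moreover have "card (prod.swap ` S \<inter> T) \<le> 1" using card_mono[OF _ PST] by simp
  ultimately have cP: "real (card P) \<le> real (card S) + real (card T)"
    "real (card S) + real (card T) \<le> real (card P) + 1" by linarith+

  have "real (card S) = (\<Sum>n=1..N. a - psi (y / (real n + 0) - 0) + psi (y / (real n + 0) - a))"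
    unfolding S_def using ok1 a
    by (subst card_SigmaI) (auto intro!: sum.cong card_nat_interval simp: card_nat_interval(2))
  also have "\<dots> = a * real N - (\<Sum>n=1..N. psi (y / (real n + 0) - 0)) + (\<Sum>n=1..N. psi (y / (real n + 0) - a))"
    by (simp add: sum.distrib sum_subtractf mult.commute)
  finally have cS: "\<bar>real (card S) - a * real N\<bar> \<le> 2 * E"
    using psi_hyperbola_sum[OF y _ _ N2, of 0 0] psi_hyperbola_sum[OF y _ _ N2, of 0 a]
    unfolding E_def by simp
  define H where "H = (\<Sum>k<N. 1 / real (Suc k) - 1 / (real (Suc k) + a))"
  have H: "(\<Sum>m=1..N. 1 / real m - 1 / (real m + a)) = H"
    unfolding H_def One_nat_def by (rule sum.atLeast1_atMost_eq)
  have "real (card T) = (\<Sum>m=1..N. y * (1 / real m - 1 / (real m + a)) - psi (y / (real m + 0) - 0)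
      + psi (y / (real m + a) - 0))"
    unfolding T_def using ok2
    by (subst card_SigmaI)
       (auto intro!: sum.cong card_nat_interval simp: card_nat_interval(2) right_diff_distrib)
  also have "\<dots> = y * H - (\<Sum>m=1..N. psi (y / (real m + 0) - 0)) + (\<Sum>m=1..N. psi (y / (real m + a) - 0))"
    unfolding H[symmetric] sum.distrib sum_subtractf[of "\<lambda>m. y * _ m"] sum_distrib_left by (rule refl)
  finally have cT: "\<bar>real (card T) - y * H\<bar> \<le> 2 * E"
    using psi_hyperbola_sum[OF y _ _ N2, of 0 0] psi_hyperbola_sum[OF y _ _ N2, of a 0] a
    unfolding E_def by simp
  have "\<bar>y * (shift_series a - H) - a * real N\<bar> \<le> 3"
  proof -
    have N0: "0 < real N" using N1 by simp
    have tail: "a / (real N + 1) \<le> shift_series a - H" "shift_series a - H \<le> a / real N"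
      unfolding H_def using N1 by (intro shift_series_bounds(3,4)[OF a]; simp)+
    have "0 \<le> a / (real N + 1)" using a by simp
    then have tail_nonneg: "0 \<le> shift_series a - H" using tail(1) by (rule order.trans)
    have "y * (shift_series a - H) \<le> (real N + 1)\<^sup>2 * (a / real N)"
      by (intro mult_mono less_imp_le[OF yN] tail tail_nonneg) simp
    also have "\<dots> = a * real N + a * (2 + 1 / real N)"
      using N0 by (simp add: field_simps power2_eq_square)
    also have "a * (2 + 1 / real N) \<le> 1 * 3" using a N1 by (intro mult_mono) auto
    finally have up: "y * (shift_series a - H) \<le> a * real N + 3" by simp
    have "a * real N - 3 \<le> a * (real N - 1)" using a by (simp add: algebra_simps)
    also have "\<dots> \<le> a * ((real N)\<^sup>2 / (real N + 1))"
      using a N0 by (intro mult_left_mono) (auto simp: field_simps power2_eq_square)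
    also have "\<dots> = (real N)\<^sup>2 * (a / (real N + 1))" by simp
    also have "\<dots> \<le> y * (shift_series a - H)"
      using y a by (intro mult_mono N2 tail) auto
    finally show ?thesis using up by linarith
  qed
  moreover have "y * (shift_series a - H) = y * shift_series a - y * H" by (simp add: algebra_simps)
  ultimately have "\<bar>real (card P) - y * shift_series a\<bar> \<le> 4 * E + 4" using cP cS cT by linarith
  \<comment> \<open>\<open>3460 = 4 * 864 + 4\<close>, and \<open>y powr (1/3) * (1 + ln y) \<ge> 1\<close>\<close>
  also have "\<dots> \<le> 3460 * (y powr (1 / 3) * (1 + ln y))"
  proof -
    have "1 * 1 \<le> y powr (1 / 3) * (1 + ln y)"
      using y by (intro mult_mono) (auto simp: ge_one_powr_ge_zero)
    then show ?thesis unfolding E_def by linarith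
  qed
  finally show ?thesis .
qed

definition quotient_count :: "real \<Rightarrow> nat \<Rightarrow> nat" where
  "quotient_count x d = card {n. 1 \<le> n \<and> real n \<le> x \<and> d dvd nat \<lfloor>x / real n\<rfloor>}"

text \<open>
  The partner of \<open>n\<close> is \<open>m = \<lfloor>x/n\<rfloor> / d\<close>: the inequalities say that \<open>d m \<le> x/n < d m + 1\<close>.
\<close>
lemma quotient_count_eq_pair_count:
  assumes x: "0 \<le> x" and d: "1 \<le> d"
  shows "quotient_count x d = card {(m::nat, n::nat). 1 \<le> m \<and> 1 \<le> n \<and>
           real m * real n \<le> x / real d \<and> x / real d < (real m + 1 / real d) * real n}"
    (is "_ = card ?P")
proof -
  have iff: "(m, n) \<in> ?P \<longleftrightarrow> 1 \<le> n \<and> real n \<le> x \<and> nat \<lfloor>x / real n\<rfloor> = d * m" for m n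
  proof (cases "1 \<le> n")
    case True
    have "nat \<lfloor>x / real n\<rfloor> = d * m \<longleftrightarrow> \<lfloor>x / real n\<rfloor> = int (d * m)"
    proof -
      have "nat z = k \<longleftrightarrow> z = int k" if "0 \<le> z" for z k using that by auto
      then show ?thesis using x by simp
    qed
    also have "\<dots> \<longleftrightarrow> real (d * m) \<le> x / real n \<and> x / real n < real (d * m) + 1"
      by (simp add: floor_eq_iff)
    also have "\<dots> \<longleftrightarrow> real m * real n \<le> x / real d \<and> x / real d < (real m + 1 / real d) * real n"
      using True d by (simp add: field_simps)
    finally have 1: "nat \<lfloor>x / real n\<rfloor> = d * m \<longleftrightarrow>
        real m * real n \<le> x / real d \<and> x / real d < (real m + 1 / real d) * real n" .
    have "1 \<le> m \<longleftrightarrow> real n \<le> x" if "nat \<lfloor>x / real n\<rfloor> = d * m"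
    proof -
      have "1 \<le> m \<longleftrightarrow> 1 \<le> d * m" using d by auto
      also have "\<dots> \<longleftrightarrow> 1 \<le> \<lfloor>x / real n\<rfloor>" unfolding that[symmetric] by linarith
      also have "\<dots> \<longleftrightarrow> real n \<le> x" using True by (simp add: le_floor_iff)
      finally show ?thesis .
    qed
    then show ?thesis using 1 True by auto
  qed auto
  have "bij_betw snd ?P {n. 1 \<le> n \<and> real n \<le> x \<and> d dvd nat \<lfloor>x / real n\<rfloor>}"
    unfolding bij_betw_def
  proof
    show "inj_on snd ?P"
    proof (rule inj_onI)
      fix p q assume "p \<in> ?P" "q \<in> ?P" and eq: "snd p = snd q"
      then have "d * fst p = d * fst q"
        using iff[of "fst p" "snd p"] iff[of "fst q" "snd q"] unfolding prod.collapse by simp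
      then show "p = q" using d eq by (simp add: prod_eq_iff)
    qed
    have "snd ` ?P = {n. \<exists>m. (m, n) \<in> ?P}" by force
    also have "\<dots> = {n. 1 \<le> n \<and> real n \<le> x \<and> d dvd nat \<lfloor>x / real n\<rfloor>}"
      unfolding iff by (auto simp: dvd_def)
    finally show "snd ` ?P = {n. 1 \<le> n \<and> real n \<le> x \<and> d dvd nat \<lfloor>x / real n\<rfloor>}" .
  qed
  then show ?thesis unfolding quotient_count_def by (rule bij_betw_same_card[symmetric])
qed

lemma quotient_count_eq_0:
  assumes "0 \<le> x" "x < real d"
  shows "quotient_count x d = 0"
proof -
  have "\<not> d dvd nat \<lfloor>x / real n\<rfloor>" if n: "1 \<le> n" "real n \<le> x" for n
  proof
    assume dvd: "d dvd nat \<lfloor>x / real n\<rfloor>"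
    have "1 \<le> x / real n" using n by simp
    then have "0 < nat \<lfloor>x / real n\<rfloor>" by (simp add: less_floor_iff zero_less_floor)
    with dvd have "d \<le> nat \<lfloor>x / real n\<rfloor>" by (rule dvd_imp_le)
    then have "real d \<le> x / real n" using assms n by (simp add: le_nat_iff le_floor_iff)
    also have "\<dots> \<le> x / 1" using assms n by (intro divide_left_mono) auto
    finally show False using assms by simp
  qed
  then have "{n. 1 \<le> n \<and> real n \<le> x \<and> d dvd nat \<lfloor>x / real n\<rfloor>} = {}" by blast
  then show ?thesis by (simp only: quotient_count_def card.empty)
qed

text \<open>
  For \<open>d > x\<close> the count is \<open>0\<close> and the main term itself is small, so the bound
  holds for every \<open>d\<close> and can be summed over all of them.
\<close>
lemma quotient_count_asymptotic:
  assumes x: "1 \<le> x" and d: "1 \<le> d"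
  shows "\<bar>real (quotient_count x d) - x / real d * shift_series (1 / real d)\<bar>
           \<le> 3460 * ((x / real d) powr (1 / 3) * (1 + ln x))"
proof (cases "real d \<le> x")
  case True
  then have y: "1 \<le> x / real d" using d by simp
  have "\<bar>real (quotient_count x d) - x / real d * shift_series (1 / real d)\<bar>
      \<le> 3460 * ((x / real d) powr (1 / 3) * (1 + ln (x / real d)))"
    unfolding quotient_count_eq_pair_count[OF order.trans[OF zero_le_one x] d]
    using d by (intro hyperbola_pair_count y) auto
  also have "\<dots> \<le> 3460 * ((x / real d) powr (1 / 3) * (1 + ln x))"
    using x d by (intro mult_left_mono add_left_mono) (auto simp: ln_div)
  finally show ?thesis .
next
  case False
  define y where "y = x / real d"
  have y: "0 < y" "y < 1" using False x d by (auto simp: y_def)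
  have "shift_series (1 / real d) \<le> 2 * (1 / real d)"
    using d by (intro shift_series_bounds(2)) auto
  also have "\<dots> \<le> 2 * 1" using d by (intro mult_left_mono) auto
  finally have "y * shift_series (1 / real d) \<le> y * (2 * 1)"
    using y by (intro mult_left_mono) auto
  also have "y * (2 * 1) \<le> 3460 * (y powr 1 * (1 + 0))" using y by simp
  also have "\<dots> \<le> 3460 * (y powr (1 / 3) * (1 + ln x))"
    using x y by (intro mult_left_mono mult_mono add_left_mono powr_mono') auto
  finally have "y * shift_series (1 / real d) \<le> 3460 * (y powr (1 / 3) * (1 + ln x))" .
  moreover have "0 \<le> y * shift_series (1 / real d)"
    using y d shift_series_bounds(1)[of "1 / real d"] by simp
  ultimately show ?thesis
    using False x by (simp add: y_def quotient_count_eq_0)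
qed

section \<open>Summation over the divisors\<close>

lemma floor_sum_sigma_neg:
  assumes x: "0 \<le> x"
  shows "(\<lambda>k. 1 / real (Suc k) powr \<beta> * real (quotient_count x (Suc k))) sums floor_sum (sigma_neg \<beta>) x"
proof -
  define D where "D = nat \<lfloor>x\<rfloor>"
  define X where "X = {n. 1 \<le> n \<and> real n \<le> x}"
  have D: "real n \<le> x \<longleftrightarrow> n \<le> D" for n
    using x by (simp add: D_def le_nat_iff le_floor_iff)
  have "X = {1..D}" unfolding X_def D by auto
  then have finX: "finite X" by simp
  have dvd: "{d. d dvd nat \<lfloor>x / real n\<rfloor>} = {d \<in> Suc ` {..<D}. d dvd nat \<lfloor>x / real n\<rfloor>}" if n: "n \<in> X" for n
  proof -
    have "1 \<le> x / real n" using n by (simp add: X_def)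
    then have pos: "0 < nat \<lfloor>x / real n\<rfloor>" by (simp add: zero_less_floor)
    have "x / real n \<le> x / 1" using n x by (intro divide_left_mono) (auto simp: X_def)
    then have "nat \<lfloor>x / real n\<rfloor> \<le> D" unfolding D_def by (intro nat_mono floor_mono) simp
    then have "d \<in> Suc ` {..<D}" if "d dvd nat \<lfloor>x / real n\<rfloor>" for d
      using dvd_imp_le[OF that pos] dvd_pos_nat[OF pos that] by (cases d) auto
    then show ?thesis by auto
  qed
  have "floor_sum (sigma_neg \<beta>) x
      = (\<Sum>n\<in>X. \<Sum>d\<in>Suc ` {..<D}. if d dvd nat \<lfloor>x / real n\<rfloor> then 1 / real d powr \<beta> else 0)"
    unfolding floor_sum_def sigma_neg_def X_def[symmetric]
  proof (rule sum.cong[OF refl])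
    fix n assume "n \<in> X"
    show "(\<Sum>d | d dvd nat \<lfloor>x / real n\<rfloor>. 1 / real d powr \<beta>)
        = (\<Sum>d\<in>Suc ` {..<D}. if d dvd nat \<lfloor>x / real n\<rfloor> then 1 / real d powr \<beta> else 0)"
      unfolding dvd[OF \<open>n \<in> X\<close>] by (rule sum.inter_filter) simp
  qed
  also have "\<dots> = (\<Sum>d\<in>Suc ` {..<D}. \<Sum>n\<in>X. if d dvd nat \<lfloor>x / real n\<rfloor> then 1 / real d powr \<beta> else 0)"
    by (rule sum.swap)
  also have "\<dots> = (\<Sum>d\<in>Suc ` {..<D}. 1 / real d powr \<beta> * real (quotient_count x d))"
  proof (rule sum.cong[OF refl])
    fix d
    have "(\<Sum>n\<in>X. if d dvd nat \<lfloor>x / real n\<rfloor> then 1 / real d powr \<beta> else 0)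
        = (\<Sum>n\<in>{n\<in>X. d dvd nat \<lfloor>x / real n\<rfloor>}. 1 / real d powr \<beta>)"
      using finX by (rule sum.inter_filter[symmetric])
    also have "\<dots> = real (card {n\<in>X. d dvd nat \<lfloor>x / real n\<rfloor>}) * (1 / real d powr \<beta>)"
      by (rule sum_constant)
    also have "{n\<in>X. d dvd nat \<lfloor>x / real n\<rfloor>} = {n. 1 \<le> n \<and> real n \<le> x \<and> d dvd nat \<lfloor>x / real n\<rfloor>}"
      by (auto simp: X_def)
    finally show "(\<Sum>n\<in>X. if d dvd nat \<lfloor>x / real n\<rfloor> then 1 / real d powr \<beta> else 0)
        = 1 / real d powr \<beta> * real (quotient_count x d)"
      by (simp only: quotient_count_def mult.commute)
  qed
  also have "\<dots> = (\<Sum>k<D. 1 / real (Suc k) powr \<beta> * real (quotient_count x (Suc k)))"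
    by (subst sum.reindex) auto
  finally have eq: "floor_sum (sigma_neg \<beta>) x = \<dots>" .
  show ?thesis unfolding eq
  proof (rule sums_finite)
    fix k assume "k \<notin> {..<D}"
    then have "x < real (Suc k)" using D[of "Suc k"] by auto
    then show "1 / real (Suc k) powr \<beta> * real (quotient_count x (Suc k)) = 0"
      using quotient_count_eq_0[OF x] by simp
  qed simp
qed

lemma has_sum_positive_iff_sums:
  fixes f :: "nat \<Rightarrow> real"
  assumes "\<And>n. 0 \<le> f (Suc n)"
  shows "(f has_sum S) {1..} \<longleftrightarrow> (\<lambda>n. f (Suc n)) sums S"
proof -
  have "bij_betw Suc UNIV {1..}"
    by (rule bij_betwI[where g = "\<lambda>n. n - 1"]) auto
  from has_sum_reindex_bij_betw[OF this, of f S]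
  have "(f has_sum S) {1..} \<longleftrightarrow> ((\<lambda>n. f (Suc n)) has_sum S) UNIV" by simp
  also have "\<dots> \<longleftrightarrow> (\<lambda>n. f (Suc n)) sums S"
  proof
    show "(\<lambda>n. f (Suc n)) sums S" if "((\<lambda>n. f (Suc n)) has_sum S) UNIV"
      using that by (rule has_sum_imp_sums)
    show "((\<lambda>n. f (Suc n)) has_sum S) UNIV" if "(\<lambda>n. f (Suc n)) sums S"
      using that by (rule sums_nonneg_imp_has_sum) (rule assms)
  qed
  finally show ?thesis .
qed

text \<open>
  Write \<open>n = d m\<close> in the double series over \<open>n\<close> and \<open>d dvd n\<close>. For fixed \<open>d\<close>, the sum of \<open>1 / (d m (d m + 1))\<close>
  over \<open>m\<close> is \<open>shift_series (1/d) / d\<close>. All terms are nonnegative, which justifies the exchange.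
\<close>
lemma floor_sum_const_sigma_neg:
  assumes \<beta>: "0 \<le> \<beta>"
  shows "(\<lambda>k. 1 / real (Suc k) powr \<beta> * (shift_series (1 / real (Suc k)) / real (Suc k)))
           sums floor_sum_const (sigma_neg \<beta>)"
proof -
  define g where "g d = 1 / real d powr \<beta> * (shift_series (1 / real d) / real d)" for d
  define w where "w d n = 1 / real d powr \<beta> * (1 / (real n * (real n + 1)))" for d n :: nat
  have w_nonneg: "0 \<le> w d n" for d n by (simp add: w_def)
  have inner: "((\<lambda>m. w d (d * m)) has_sum g d) {1..}" if d: "d \<in> {1..}" for d
  proof -
    have "(\<lambda>k. 1 / real d powr \<beta> * ((1 / real (Suc k) - 1 / (real (Suc k) + 1 / real d)) / real d)) sums g d"
      unfolding g_def shift_series_def using d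
      by (intro sums_mult sums_divide summable_sums summable_shift_series) auto
    moreover have "1 / real d powr \<beta> * ((1 / real (Suc k) - 1 / (real (Suc k) + 1 / real d)) / real d)
        = w d (d * Suc k)" for k
    proof -
      have d0: "0 < real d" using d by simp
      define z where "z = real (Suc k)"
      have z: "0 < z" by (simp add: z_def)
      have "0 < real d * z + 1" using d0 z by (intro add_pos_pos mult_pos_pos) auto
      then have "(1 / z - 1 / (z + 1 / real d)) / real d = 1 / ((real d * z) * (real d * z + 1))"
        using d0 z by (simp add: divide_simps) (simp add: algebra_simps)
      then show ?thesis unfolding w_def of_nat_mult z_def[symmetric] by simp
    qed
    ultimately show ?thesis
      using w_nonneg by (subst has_sum_positive_iff_sums) auto
  qed
  have g_nonneg: "0 \<le> g (Suc k)" for k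
    unfolding g_def by (simp add: shift_series_bounds(1))
  have "summable (\<lambda>k. g (Suc k))"
  proof (rule summable_comparison_test')
    show "summable (\<lambda>k. 2 * (1 / (real (Suc k))\<^sup>2))"
      using summable_inverse_square by (intro summable_mult) (subst summable_Suc_iff)
    fix k
    define z where "z = real (Suc k)"
    have z: "1 \<le> z" by (simp add: z_def)
    have "1 / z powr \<beta> * (shift_series (1 / z) / z) \<le> 1 * (2 * (1 / z) / z)"
    proof (intro mult_mono divide_right_mono)
      show "shift_series (1 / z) \<le> 2 * (1 / z)" using z by (intro shift_series_bounds(2)) auto
      show "1 / z powr \<beta> \<le> 1" using z \<beta> by (simp add: ge_one_powr_ge_zero)
      show "0 \<le> shift_series (1 / z) / z" using z by (simp add: shift_series_bounds(1))
    qed (use z in auto)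
    then have "g (Suc k) \<le> 2 * (1 / z\<^sup>2)" by (simp add: g_def z_def power2_eq_square)
    then show "norm (g (Suc k)) \<le> 2 * (1 / (real (Suc k))\<^sup>2)"
      using g_nonneg by (simp add: z_def)
  qed
  then have outer: "(g has_sum (\<Sum>k. g (Suc k))) {1..}"
    using g_nonneg by (subst has_sum_positive_iff_sums) auto
  define S where "S = (\<Sum>k. g (Suc k))"
  have "((\<lambda>(d, m). w d (d * m)) has_sum S) ({1..} \<times> {1..})"
  proof (rule has_sum_SigmaI)
    show "(g has_sum S) {1..}" unfolding S_def by (rule outer)
    show "(\<lambda>(d, m). w d (d * m)) summable_on {1..} \<times> {1..}"
    proof (rule summable_on_SigmaI)
      show "g summable_on {1..}" using outer by (rule has_sum_imp_summable)
    qed (use inner w_nonneg in auto)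
  qed (use inner in auto)
  also have "?this \<longleftrightarrow> ((\<lambda>(n, d). w d n) has_sum S) (SIGMA n:{1..}. {d. d dvd n})"
    by (rule has_sum_reindex_bij_witness[where j = "\<lambda>(d, m). (d * m, d)" and i = "\<lambda>(n, d). (d, n div d)"])
       (auto simp: dvd_div_eq_0_iff Suc_le_eq dvd_imp_le intro!: Nat.gr0I)
  finally have "((\<lambda>n. \<Sum>d | d dvd n. w d n) has_sum S) {1..}"
    by (rule has_sum_SigmaD) (auto intro!: has_sum_finite)
  moreover have "(\<Sum>d | d dvd n. w d n) = sigma_neg \<beta> n / (real n * (real n + 1))" for n
    by (simp add: w_def sigma_neg_def sum_divide_distrib)
  ultimately have "((\<lambda>n. sigma_neg \<beta> n / (real n * (real n + 1))) has_sum S) {1..}" by simp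
  then have "(\<lambda>n. sigma_neg \<beta> (Suc n) / (real (Suc n) * (real (Suc n) + 1))) sums S"
    by (subst (asm) has_sum_positive_iff_sums) (auto simp: sigma_neg_def intro!: divide_nonneg_nonneg sum_nonneg)
  then have "floor_sum_const (sigma_neg \<beta>) = S"
    by (simp add: floor_sum_const_def sums_iff)
  then show ?thesis
    using \<open>summable (\<lambda>k. g (Suc k))\<close> by (simp add: S_def g_def sums_iff)
qed

theorem corollary1p4:
  fixes \<beta> :: real
  assumes "\<beta> \<in> {2/3<..1}"
  shows "(\<lambda>x::real. floor_sum (sigma_neg \<beta>) x - floor_sum_const (sigma_neg \<beta>) * x)
           \<in> O[at_top](\<lambda>x. x powr (1/3) * ln x)"
proof -
  define Z where "Z = (\<Sum>k. real (Suc k) powr (- \<beta> - 1 / 3))"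
  have summ: "summable (\<lambda>k. real (Suc k) powr (- \<beta> - 1 / 3))"
    using assms by (subst summable_Suc_iff) (simp add: summable_real_powr_iff)
  have main: "\<bar>floor_sum (sigma_neg \<beta>) x - floor_sum_const (sigma_neg \<beta>) * x\<bar>
      \<le> 3460 * Z * (x powr (1 / 3) * (1 + ln x))" if x: "1 \<le> x" for x
  proof -
    define u where "u k = 1 / real (Suc k) powr \<beta> *
      (real (quotient_count x (Suc k)) - x / real (Suc k) * shift_series (1 / real (Suc k)))" for k
    define v where "v k = real (Suc k) powr (- \<beta> - 1 / 3) * (3460 * (x powr (1 / 3) * (1 + ln x)))" for k
    have u: "u sums (floor_sum (sigma_neg \<beta>) x - floor_sum_const (sigma_neg \<beta>) * x)"
    proof -
      have "(\<lambda>k. 1 / real (Suc k) powr \<beta> * real (quotient_count x (Suc k))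
          - 1 / real (Suc k) powr \<beta> * (shift_series (1 / real (Suc k)) / real (Suc k)) * x)
          sums (floor_sum (sigma_neg \<beta>) x - floor_sum_const (sigma_neg \<beta>) * x)"
        using assms x by (intro sums_diff sums_mult2 floor_sum_sigma_neg floor_sum_const_sigma_neg) auto
      then show ?thesis unfolding u_def by (simp add: right_diff_distrib mult_ac)
    qed
    have v: "v sums (Z * (3460 * (x powr (1 / 3) * (1 + ln x))))"
      unfolding v_def Z_def by (intro sums_mult2 summable_sums summ)
    have uv: "\<bar>u k\<bar> \<le> v k" for k
    proof -
      define d where "d = real (Suc k)"
      have d: "0 < d" by (simp add: d_def)
      have "\<bar>u k\<bar> \<le> 1 / d powr \<beta> * (3460 * ((x / d) powr (1 / 3) * (1 + ln x)))"
        unfolding u_def d_def abs_mult using quotient_count_asymptotic[OF x, of "Suc k"]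
        by (intro mult_mono) auto
      also have "\<dots> = d powr (- \<beta> - 1 / 3) * (3460 * (x powr (1 / 3) * (1 + ln x)))"
        using d x by (simp add: powr_divide powr_diff powr_minus_divide)
      finally show ?thesis by (simp add: v_def d_def)
    qed
    have "floor_sum (sigma_neg \<beta>) x - floor_sum_const (sigma_neg \<beta>) * x
        \<le> Z * (3460 * (x powr (1 / 3) * (1 + ln x)))"
      by (rule sums_le[OF _ u v]) (use uv in \<open>simp add: abs_le_iff\<close>)
    moreover have "- (floor_sum (sigma_neg \<beta>) x - floor_sum_const (sigma_neg \<beta>) * x)
        \<le> Z * (3460 * (x powr (1 / 3) * (1 + ln x)))"
      by (rule sums_le[OF _ sums_minus[OF u] v]) (use uv in \<open>simp add: abs_le_iff\<close>)
    ultimately show ?thesis by (simp add: abs_le_iff mult_ac)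
  qed
  show ?thesis
  proof (rule bigoI[where c = "6920 * Z"])
    show "\<forall>\<^sub>F x in at_top. norm (floor_sum (sigma_neg \<beta>) x - floor_sum_const (sigma_neg \<beta>) * x)
        \<le> 6920 * Z * norm (x powr (1 / 3) * ln x)"
      \<comment> \<open>from \<open>x \<ge> exp 1\<close> on, \<open>1 + ln x \<le> 2 * ln x\<close>\<close>
      using eventually_ge_at_top[of "exp 1 :: real"]
    proof eventually_elim
      case (elim x)
      have x: "1 \<le> x" using elim one_le_exp_iff[of "1::real"] by linarith
      have l: "1 \<le> ln x" using elim x by (subst ln_ge_iff) auto
      have "0 \<le> Z" unfolding Z_def by (intro suminf_nonneg summ) simp
      then have "3460 * Z * (x powr (1 / 3) * (1 + ln x)) \<le> 3460 * Z * (x powr (1 / 3) * (2 * ln x))"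
        using l by (intro mult_left_mono) auto
      with main[OF x] have "\<bar>floor_sum (sigma_neg \<beta>) x - floor_sum_const (sigma_neg \<beta>) * x\<bar>
          \<le> 3460 * Z * (x powr (1 / 3) * (2 * ln x))" by (rule order.trans)
      then show ?case using l by (simp add: abs_mult)
    qed
  qed
qed

end
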